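(* For all $x>0$ and all bounded continuous functions $f:\mathbb{R}\to\mathbb{R}$, \[\lim_{t\downarrow 0}\frac1t\,E_x\big(f(X_t)\mathbf 1_{\{T\le t,\;X_t\in(0,\infty)\}}\big)=\frac{f(x)}{x^{\alpha}}\Big(k-\frac{c_-}{\alpha}\Big).\]
   Context: Fix $\alpha\in(0,2)$ and constants $c_+,c_-\ge 0$ with $c_++c_->0$. Under $P_x$ (expectation $E_x$), $X=(X_t)_{t\ge0}$ is a stable Lévy process of index $\alpha$ with càdlàg paths, started at $x\in\mathbb{R}$, with $E_0[e^{i\lambda X_t}]=e^{t\psi(\lambda)}$, where \[\psi(\lambda)=ia\lambda+\int_{\mathbb{R}}(e^{i\lambda y}-1-i\lambda y\mathbf 1_{\{|y|<1\}})\,\nu(y)\,dy,\qquad \nu(y)=c_+y^{-\alpha-1}\mathbf 1_{\{y>0\}}+c_-|y|^{-\alpha-1}\mathbf 1_{\{y<0\}}.\] If $\alpha\ne1$, then $a=\frac{c_+-c_-}{1-\alpha}$; if $\alpha=1$, the process is a symmetric Cauchy process, i.e. $c_+=c_-$ and $a=0$. It is assumed that neither $X$ nor $-X$ is a subordinator. Put $T=\inf\{t\ge0:X_t\le0\}$ and $\rho=P_0(X_1<0)$. The constant $k$: if $\alpha\neq1$, let $c=-(c_++c_-)\Gamma(-\alpha)\cos\frac{\pi\alpha}{2}$ and $\beta=\frac{c_+-c_-}{c_++c_-}$, so that $E_0[e^{i\lambda X_t}]=\exp[-ct|\lambda|^\alpha(1-i\beta\,\mathrm{sgn}(\lambda)\tan(\pi\alpha/2))]$,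 and set \[k=\frac{c\,(1+\beta^2\tan^2(\pi\alpha/2))^{1/2}\,\Gamma(\alpha)\sin(\pi\alpha\rho)}{\pi};\] if $\alpha=1$, set $k=c_+$ $(=c_-)$. *)

theory Defs
  imports "HOL-Probability.Probability"
begin

section \<open>Real Levy processes with cadlag paths\<close>

definition cadlag_on_nonneg :: "(real \<Rightarrow> real) \<Rightarrow> bool" where
  "cadlag_on_nonneg g \<longleftrightarrow>
     (\<forall>t\<ge>0. (g \<longlongrightarrow> g t) (at_right t)) \<and>
     (\<forall>t>0. \<exists>l. (g \<longlongrightarrow> l) (at_left t))"

text \<open>Time is the half-line \<open>t \<ge> 0\<close>; the values of \<open>X\<close> at negative times are irrelevant.\<close>

locale levy_process = prob_space M
  for M :: "'a measure" +
  fixes X :: "real \<Rightarrow> 'a \<Rightarrow> real" and x :: real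
  assumes measurable_X: "\<And>t. 0 \<le> t \<Longrightarrow> X t \<in> borel_measurable M"
    and cadlag_paths: "\<And>\<omega>. \<omega> \<in> space M \<Longrightarrow> cadlag_on_nonneg (\<lambda>t. X t \<omega>)"
    and start: "AE \<omega> in M. X 0 \<omega> = x"
    and indep_increments:
      "\<And>(ts :: nat \<Rightarrow> real) n. 0 \<le> ts 0 \<Longrightarrow> mono_on {..n} ts \<Longrightarrow>
         indep_vars (\<lambda>_. borel) (\<lambda>i \<omega>. X (ts (Suc i)) \<omega> - X (ts i) \<omega>) {..<n}"
    and stationary_increments:
      "\<And>s t. 0 \<le> s \<Longrightarrow> 0 \<le> t \<Longrightarrow>
         distr M borel (\<lambda>\<omega>. X (s + t) \<omega> - X s \<omega>) = distr M borel (\<lambda>\<omega>. X t \<omega> - X 0 \<omega>)"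

definition subordinator :: "'a measure \<Rightarrow> (real \<Rightarrow> 'a \<Rightarrow> real) \<Rightarrow> bool" where
  "subordinator M X \<longleftrightarrow>
     levy_process M X 0 \<and> (AE \<omega> in M. mono_on {0..} (\<lambda>t. X t \<omega>))"

section \<open>Stable processes\<close>

definition stable_levy_density :: "real \<Rightarrow> real \<Rightarrow> real \<Rightarrow> real \<Rightarrow> real" where
  "stable_levy_density \<alpha> cp cm y =
     cp * y powr (- \<alpha> - 1) * indicator {0<..} y +
     cm * \<bar>y\<bar> powr (- \<alpha> - 1) * indicator {..<0} y"

definition stable_drift :: "real \<Rightarrow> real \<Rightarrow> real \<Rightarrow> real" where
  "stable_drift \<alpha> cp cm = (if \<alpha> = 1 then 0 else (cp - cm) / (1 - \<alpha>))"

definition stable_exponent :: "real \<Rightarrow> real \<Rightarrow> real \<Rightarrow> real \<Rightarrow> complex" where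
  "stable_exponent \<alpha> cp cm u =
     \<i> * of_real (stable_drift \<alpha> cp cm * u) +
     (CLINT y|lborel.
        (iexp (u * y) - 1 - \<i> * of_real (u * y * indicator {y. \<bar>y\<bar> < 1} y))
          * of_real (stable_levy_density \<alpha> cp cm y))"

text \<open>
  The displacement \<open>X t - x\<close> is used so that one predicate describes the law \<open>P\<^sub>x\<close> for every
  starting point. For \<open>\<alpha> = 1\<close> it yields the symmetric Cauchy process provided that \<open>cp = cm\<close>,
  which is to be assumed separately.
\<close>

definition stable_process ::
    "real \<Rightarrow> real \<Rightarrow> real \<Rightarrow> 'a measure \<Rightarrow> (real \<Rightarrow> 'a \<Rightarrow> real) \<Rightarrow> real \<Rightarrow> bool" where
  "stable_process \<alpha> cp cm M X x \<longleftrightarrow>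
     levy_process M X x \<and>
     (\<forall>t\<ge>0. \<forall>u. char (distr M borel (\<lambda>\<omega>. X t \<omega> - x)) u
                 = exp (of_real t * stable_exponent \<alpha> cp cm u))"

definition negativity_parameter :: "'a measure \<Rightarrow> (real \<Rightarrow> 'a \<Rightarrow> real) \<Rightarrow> real" where
  "negativity_parameter M X = measure M {\<omega> \<in> space M. X 1 \<omega> < 0}"

text \<open>The infimum is taken in \<^typ>\<open>ereal\<close>, so it is \<open>\<infinity>\<close> if the path stays in \<open>(0, \<infinity>)\<close>.\<close>

definition passage_time :: "(real \<Rightarrow> 'a \<Rightarrow> real) \<Rightarrow> 'a \<Rightarrow> ereal" where
  "passage_time X \<omega> = Inf {ereal t | t. 0 \<le> t \<and> X t \<omega> \<le> 0}"

text \<open>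
  Expectations of functionals of the passage time must be taken with respect to the completed
  measure: the entrance time of a cadlag path into a closed set is in general measurable only after
  completion, and the Bochner integral of a non-measurable function is \<open>0\<close> by convention.
\<close>

abbreviation expectation_completed :: "'a measure \<Rightarrow> ('a \<Rightarrow> real) \<Rightarrow> real" where
  "expectation_completed M g \<equiv> integral\<^sup>L (completion M) g"

section \<open>The constant\<close>

definition stable_scale :: "real \<Rightarrow> real \<Rightarrow> real \<Rightarrow> real" where
  "stable_scale \<alpha> cp cm = - (cp + cm) * Gamma (- \<alpha>) * cos (pi * \<alpha> / 2)"

definition stable_skewness :: "real \<Rightarrow> real \<Rightarrow> real" where
  "stable_skewness cp cm = (cp - cm) / (cp + cm)"

definition passage_constant :: "real \<Rightarrow> real \<Rightarrow> real \<Rightarrow> real \<Rightarrow> real" where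
  "passage_constant \<alpha> cp cm \<rho> =
     (if \<alpha> = 1 then cp
      else stable_scale \<alpha> cp cm
             * sqrt (1 + (stable_skewness cp cm)\<^sup>2 * (tan (pi * \<alpha> / 2))\<^sup>2)
             * Gamma \<alpha> * sin (pi * \<alpha> * \<rho>) / pi)"

end

theory Submission
  imports Defs "HOL-Real_Asymp.Real_Asymp"
begin

text \<open>
  The right-hand side is always \<open>0\<close>. For \<open>\<alpha> = 1\<close> this is immediate; otherwise the integrals of
  \<open>1 - cos y\<close> and of the compensated sine against \<open>y powr (- \<alpha> - 1)\<close> determine the exponent, the Gil-Pelaez
  formula gives \<open>\<rho> = 1/2 - arctan (\<beta> tan (\<pi>\<alpha>/2)) / (\<pi>\<alpha>)\<close>, and the reflection formula for the Gamma
  function turns \<open>k\<close> into \<open>cm / \<alpha>\<close>.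

  As \<open>f\<close> is bounded, it remains to see that \<open>P\<^sub>x(T \<le> t, X\<^sub>t > 0) = o(t)\<close>. Either \<open>0 < X\<^sub>t \<le> 2\<delta>\<close>, which has
  probability at most \<open>e t\<close> for small \<open>t\<close> if \<open>\<delta>\<close> is small, since \<open>P\<^sub>0(X\<^sub>t \<in> dy) / t\<close> converges to the Levy
  measure away from \<open>0\<close> and the Levy measure has no atoms; or the path makes two successive displacements of
  size at least \<open>\<delta>\<close>, which has probability \<open>O(t\<^sup>2)\<close> by Ottaviani's inequality on dyadic grids.
\<close>

section \<open>Integrals of trigonometric functions against powers\<close>

text \<open>The limit vanishes because at small times a path gets from x below 0 by one large
  displacement, and coming back costs a second one. Since c_- / (\<alpha> x^\<alpha>) is the Levy
  measure of the half-line below -x, the identity k = c_- / \<alpha> says that k accounts for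
  exactly that one jump.

  The first obstacle is that \<open>stable_process\<close> prescribes the laws only through their
  characteristic functions: neither a density nor a scaling relation is given. All analytic
  information is therefore extracted by Fourier means. Tails come from averaging 1 -
  \<open>char\<close> over a Gaussian; local information comes from tilting by 1 - cos (y / x),
  which turns the infinite Levy measure into a finite one, so that Levy's continuity theorem
  applies.

  The second obstacle is that the passage event may fail to be measurable for \<open>P x\<close>. It
  is never measured itself: it is covered by an increasing union of events that look at finitely
  many times, and the expectation under the completion is compared with the measure of that
  cover.\<close>

text \<open>Bridge from gauge to Lebesgue integrals: for a nonnegative function a finite gauge
  integral is already absolute convergence.\<close>

lemma set_integrable_lborel_nonneg:
  fixes f :: "real \<Rightarrow> real"
  assumes "f \<in> borel_measurable borel" "S \<in> sets borel"
    and "\<And>y. y \<in> S \<Longrightarrow> 0 \<le> f y" "(f has_integral I) S"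
  shows "set_integrable lborel S f" "(LINT y:S|lborel. f y) = I"
proof -
  have "f absolutely_integrable_on S"
    using assms by (intro nonnegative_absolutely_integrable_1) auto
  then show *: "set_integrable lborel S f"
    using assms unfolding set_integrable_def
    by (simp add: integrable_completion)
  show "(LINT y:S|lborel. f y) = I"
    using set_borel_integral_eq_integral(2)[OF *] assms(4) by (simp add: integral_unique)
qed

lemma Gamma_reflection_real:
  "Gamma p * Gamma (1 - p) = pi / sin (pi * p)" for p :: real
proof -
  have "complex_of_real (Gamma p * Gamma (1 - p)) = Gamma (of_real p) * Gamma (1 - of_real p)"
    by (metis Gamma_complex_of_real of_real_1 of_real_diff of_real_mult)
  also have "\<dots> = of_real (pi / sin (pi * p))"
    by (metis Gamma_reflection_complex of_real_divide of_real_mult sin_of_real)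
  finally show ?thesis
    by (simp only: of_real_eq_iff)
qed

text \<open>The substitution u = t^2 / (1 + t^2) maps the half-line onto (0, 1) and produces twice
  this integrand from that of the Beta integral B(s/2, 1 - s/2), which reflection evaluates. This is
  the integral left over when 1 - cos is integrated against a power.\<close>

lemma rational_power_integral:
  fixes s :: real
  assumes "0 < s" "s < 2"
  shows "set_integrable lborel {0<..} (\<lambda>t. t powr (s - 1) / (1 + t\<^sup>2))"
    and "(LINT t:{0<..}|lborel. t powr (s - 1) / (1 + t\<^sup>2)) = pi / (2 * sin (pi * s / 2))"
proof -
  define p where "p = s / 2"
  define g :: "real \<Rightarrow> real" where "g t = t\<^sup>2 / (1 + t\<^sup>2)" for t
  define g' :: "real \<Rightarrow> real" where "g' t = 2 * t / (1 + t\<^sup>2)\<^sup>2" for t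
  define f where "f u = u powr (p - 1) * (1 - u) powr ((1 - p) - 1)" for u :: real
  have p: "0 < p" "p < 1" using assms by (auto simp: p_def)
  have pos: "0 < 1 + t\<^sup>2" for t :: real
    by (simp add: add_pos_nonneg)
  have image: "g ` {0<..} = {0<..<1}"
  proof
    show "g ` {0<..} \<subseteq> {0<..<1}"
      using pos by (auto simp: g_def)
    show "{0<..<1} \<subseteq> g ` {0<..}"
    proof
      fix u :: real assume u: "u \<in> {0<..<1}"
      then have "g (sqrt (u / (1 - u))) = u"
        by (simp add: g_def field_simps)
      moreover have "sqrt (u / (1 - u)) \<in> {0<..}" using u by simp
      ultimately show "u \<in> g ` {0<..}" by (metis imageI)
    qed
  qed
  have "inj_on g {0<..}"
  proof (rule inj_onI)
    fix a b :: real assume "a \<in> {0<..}" "b \<in> {0<..}" "g a = g b"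
    then have "a\<^sup>2 = b\<^sup>2"
      using pos[of a] pos[of b] by (simp add: g_def frac_eq_eq algebra_simps)
    then show "a = b" using \<open>a \<in> _\<close> \<open>b \<in> _\<close> by simp
  qed
  have der: "(g has_field_derivative g' t) (at t within {0<..})" for t
    unfolding g_def g'_def using pos[of t]
    by (auto intro!: derivative_eq_intros simp: field_simps power2_eq_square)
  have "(f has_integral Beta p (1 - p)) {0..1}"
    unfolding f_def using p by (intro has_integral_Beta_real) auto
  then have B: "(f has_integral Beta p (1 - p)) {0<..<1}"
    using has_integral_Icc_iff_Ioo by blast
  have "f absolutely_integrable_on {0<..<1}"
    using B by (intro nonnegative_absolutely_integrable_1) (auto simp: f_def)
  with integral_unique[OF B]
  have "f absolutely_integrable_on (g ` {0<..}) \<and> integral (g ` {0<..}) f = Beta p (1 - p)"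
    unfolding image by (rule conjI[rotated])
  moreover have "{0::real<..} \<in> sets lebesgue"
    by simp
  ultimately have h: "(\<lambda>t. \<bar>g' t\<bar> * f (g t)) absolutely_integrable_on {0<..}"
    "integral {0<..} (\<lambda>t. \<bar>g' t\<bar> * f (g t)) = Beta p (1 - p)"
    using has_absolute_integral_change_of_variables_1'[OF _ der \<open>inj_on g _\<close>, of f "Beta p (1 - p)"]
    by blast+
  have eq: "\<bar>g' t\<bar> * f (g t) = 2 * (t powr (s - 1) / (1 + t\<^sup>2))" if "t \<in> {0<..}" for t
  proof -
    define q where "q = 1 + t\<^sup>2"
    have t: "0 < t" "0 < q" using that pos by (auto simp: q_def)
    have 1: "g t powr (p - 1) = (t powr 2) powr (p - 1) / q powr (p - 1)"
      using t by (simp add: g_def q_def powr_divide)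
    have "1 - g t = 1 / q"
      using t by (simp add: g_def q_def field_simps)
    then have 2: "(1 - g t) powr ((1 - p) - 1) = q powr p"
      using t by (simp add: powr_divide powr_minus_divide)
    have 3: "q powr p = q * q powr (p - 1)"
      using t by (simp add: powr_diff)
    have 4: "t powr (s - 1) = t * (t powr 2) powr (p - 1)"
      using t powr_powr[of t 2 "p - 1"] powr_add[of t 1 "2 * (p - 1)"] by (simp add: p_def algebra_simps)
    have "\<bar>g' t\<bar> * f (g t) = 2 * t / q\<^sup>2 * ((t powr 2) powr (p - 1) / q powr (p - 1) * (q * q powr (p - 1)))"
      using t unfolding f_def 1 2 3 by (simp add: g'_def q_def)
    also have "\<dots> = 2 * (t * (t powr 2) powr (p - 1) / q)"
      using t by (simp add: field_simps power2_eq_square)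
    finally show ?thesis unfolding 4 q_def .
  qed
  have "((\<lambda>t. \<bar>g' t\<bar> * f (g t)) has_integral Beta p (1 - p)) {0<..}"
    using set_lebesgue_integral_eq_integral(1)[OF h(1)] h(2) integrable_integral by fastforce
  then have "((\<lambda>t. 2 * (t powr (s - 1) / (1 + t\<^sup>2))) has_integral Beta p (1 - p)) {0<..}"
    by (rule has_integral_eq[rotated]) (rule eq)
  from has_integral_mult_right[OF this, of "1/2"]
  have I: "((\<lambda>t. t powr (s - 1) / (1 + t\<^sup>2)) has_integral Beta p (1 - p) / 2) {0<..}"
    by simp
  have "Beta p (1 - p) = pi / sin (pi * p)"
    unfolding Beta_def by (simp add: Gamma_reflection_real)
  with set_integrable_lborel_nonneg[OF _ _ _ I]
  show "set_integrable lborel {0<..} (\<lambda>t. t powr (s - 1) / (1 + t\<^sup>2))"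
    "(LINT t:{0<..}|lborel. t powr (s - 1) / (1 + t\<^sup>2)) = pi / (2 * sin (pi * s / 2))"
    by (auto simp: p_def)
qed

lemma set_integrable_power_bounds:
  fixes f :: "real \<Rightarrow> 'b::{banach, second_countable_topology}"
  assumes [measurable]: "f \<in> borel_measurable borel"
    and "-1 < p" "q < -1"
    and "\<And>y. 0 < y \<Longrightarrow> y \<le> 1 \<Longrightarrow> norm (f y) \<le> C * y powr p"
    and "\<And>y. 1 < y \<Longrightarrow> norm (f y) \<le> C * y powr q"
  shows "set_integrable lborel {0<..} f"
proof -
  have C: "0 \<le> C"
    using norm_ge_zero[of "f 1"] assms(4)[of 1] by (simp del: norm_ge_zero)
  have "set_integrable lborel {0..1} (\<lambda>y. y powr p)"
    using assms(2) by (intro set_integrable_lborel_nonneg(1)[OF _ _ _ has_integral_powr_from_0]) auto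
  moreover have "set_integrable lborel {1..} (\<lambda>y. y powr q)"
    using assms(3) by (intro set_integrable_lborel_nonneg(1)[OF _ _ _ has_integral_powr_to_inf]) auto
  ultimately have "integrable lborel (\<lambda>y. C * (indicator {0..1} y *\<^sub>R y powr p) + C * (indicator {1..} y *\<^sub>R y powr q))"
    unfolding set_integrable_def
    by (intro Bochner_Integration.integrable_add integrable_mult_right)
  then show ?thesis
    unfolding set_integrable_def
  proof (rule Bochner_Integration.integrable_bound)
    show "AE y in lborel. norm (indicator {0<..} y *\<^sub>R f y)
        \<le> norm (C * (indicator {0..1} y *\<^sub>R y powr p) + C * (indicator {1..} y *\<^sub>R y powr q))"
    proof (rule AE_I2)
      fix y :: real
      consider "y \<le> 0" | "0 < y" "y \<le> 1" | "1 < y" by linarith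
      then show "norm (indicator {0<..} y *\<^sub>R f y)
          \<le> norm (C * (indicator {0..1} y *\<^sub>R y powr p) + C * (indicator {1..} y *\<^sub>R y powr q))"
        using assms(4)[of y] assms(5)[of y] C
        by cases (auto intro: order_trans simp: indicator_def)
    qed
  qed simp
qed

text \<open>Writes a negative power of y as a mixture of exponentials, so that an integral against a
  power becomes an iterated one whose inner integral is a Laplace transform. With nonnegative
  integrals, Tonelli's theorem needs no integrability check.\<close>

lemma Gamma_nn_integral_scaled:
  fixes a y :: real
  assumes "0 < a" "0 < y"
  shows "(\<integral>\<^sup>+t. ennreal (indicator {0<..} t * (t powr (a - 1) * exp (- (t * y)))) \<partial>lborel) = ennreal (Gamma a * y powr (- a))"
proof -
  define h where "h = (\<lambda>t. ennreal (indicator {0..} t * t powr (a - 1) / exp t))"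
  have "ennreal (Gamma a) = (\<integral>\<^sup>+t. h t \<partial>lborel)"
    unfolding h_def using Gamma_conv_nn_integral_real[OF assms(1)] .
  also have "\<dots> = ennreal \<bar>y\<bar> * (\<integral>\<^sup>+t. h (0 + y * t) \<partial>lborel)"
    unfolding h_def using assms by (intro nn_integral_real_affine) auto
  also have "\<dots> = (\<integral>\<^sup>+t. ennreal \<bar>y\<bar> * h (0 + y * t) \<partial>lborel)"
    unfolding h_def by (intro nn_integral_cmult[symmetric]) auto
  also have "\<dots> = (\<integral>\<^sup>+t. ennreal (y powr a) * ennreal (indicator {0<..} t * (t powr (a - 1) * exp (- (t * y)))) \<partial>lborel)"
  proof (intro nn_integral_cong_AE AE_I2)
    fix t :: real
    show "ennreal \<bar>y\<bar> * h (0 + y * t) = ennreal (y powr a) * ennreal (indicator {0<..} t * (t powr (a - 1) * exp (- (t * y))))"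
    proof (cases "0 < t")
      case True
      then have "y * ((y * t) powr (a - 1) / exp (y * t)) = y powr a * (t powr (a - 1) * exp (- (t * y)))"
        using assms powr_add[of y 1 "a - 1"] by (simp add: powr_mult exp_minus field_simps)
      with True assms show ?thesis
        unfolding h_def by (simp flip: ennreal_mult)
    next
      case False
      with assms show ?thesis unfolding h_def
        by (cases "t = 0") (auto simp: indicator_def zero_le_mult_iff)
    qed
  qed
  also have "\<dots> = ennreal (y powr a) * (\<integral>\<^sup>+t. ennreal (indicator {0<..} t * (t powr (a - 1) * exp (- (t * y)))) \<partial>lborel)"
    by (intro nn_integral_cmult) auto
  finally have "ennreal (y powr (- a)) * ennreal (Gamma a) = ennreal (y powr (- a)) * ennreal (y powr a) *
      (\<integral>\<^sup>+t. ennreal (indicator {0<..} t * (t powr (a - 1) * exp (- (t * y)))) \<partial>lborel)"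
    by (simp add: mult.assoc)
  moreover have "ennreal (y powr (- a)) * ennreal (y powr a) = 1"
    using assms by (simp flip: ennreal_mult powr_add)
  ultimately show ?thesis
    using assms by (simp add: mult.commute Gamma_real_pos less_imp_le flip: ennreal_mult)
qed

lemma Laplace_one_minus_cos_nn_integral:
  assumes "0 < t"
  shows "(\<integral>\<^sup>+y. ennreal (indicator {0<..} y * ((1 - cos y) * exp (- (t * y)))) \<partial>lborel) = ennreal (1 / (t * (1 + t\<^sup>2)))"
proof -
  define q where "q = 1 + t\<^sup>2"
  have q: "0 < q" by (simp add: q_def add_pos_nonneg)
  \<comment> \<open>The antiderivative is assembled from those of the pure and of the cosine-damped
    exponential. Its value at 0 is -1/t + t/q, which gives 1/t - t/q = 1/(t q).\<close>
  let ?F = "\<lambda>y. - (exp (- (t * y)) / t) - exp (- (t * y)) * (sin y - t * cos y) / q"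
  have der: "(?F has_real_derivative (1 - cos y) * exp (- (t * y))) (at y)" for y
  proof -
    have "(?F has_real_derivative exp (- (t * y)) - (exp (- (t * y)) * (cos y + t * sin y) - t * exp (- (t * y)) * (sin y - t * cos y)) / q) (at y)"
      using assms q by (auto intro!: derivative_eq_intros simp: field_simps)
    moreover have "exp (- (t * y)) * (cos y + t * sin y) - t * exp (- (t * y)) * (sin y - t * cos y) = exp (- (t * y)) * cos y * q"
      by (simp add: q_def algebra_simps power2_eq_square)
    ultimately show ?thesis
      using q by (simp add: algebra_simps)
  qed
  have l: "((\<lambda>y. exp (- (t * y))) \<longlongrightarrow> 0) at_top"
    using assms by real_asymp
  have "((\<lambda>y. exp (- (t * y)) * (sin y - t * cos y)) \<longlongrightarrow> 0) at_top"
  proof (rule Lim_null_comparison[where g = "\<lambda>y. exp (- (t * y)) * (1 + t)"])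
    have "\<bar>sin y - t * cos y\<bar> \<le> 1 + t" for y
    proof -
      have "\<bar>sin y - t * cos y\<bar> \<le> \<bar>sin y\<bar> + t * \<bar>cos y\<bar>"
        using assms abs_triangle_ineq4[of "sin y" "t * cos y"] by (simp add: abs_mult)
      also have "\<dots> \<le> 1 + t * 1"
        using assms by (intro add_mono mult_left_mono) auto
      finally show ?thesis by simp
    qed
    then show "\<forall>\<^sub>F y in at_top. norm (exp (- (t * y)) * (sin y - t * cos y)) \<le> exp (- (t * y)) * (1 + t)"
      by (intro always_eventually allI) (simp add: abs_mult)
    show "((\<lambda>y. exp (- (t * y)) * (1 + t)) \<longlongrightarrow> 0) at_top"
      using l by (auto intro: tendsto_mult_left_zero)
  qed
  then have lim: "(?F \<longlongrightarrow> - (0 / t) - 0 / q) at_top"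
    using l assms q by (intro tendsto_intros) auto
  have "(\<integral>\<^sup>+y. ennreal (indicator {0<..} y * ((1 - cos y) * exp (- (t * y)))) \<partial>lborel)
      = (\<integral>\<^sup>+y. ennreal ((1 - cos y) * exp (- (t * y))) * indicator {0..} y \<partial>lborel)"
    by (intro nn_integral_cong) (auto simp: indicator_def)
  also have "\<dots> = ennreal ((- (0 / t) - 0 / q) - ?F 0)"
    by (intro nn_integral_FTC_atLeast der lim) auto
  also have "(- (0 / t) - 0 / q) - ?F 0 = 1 / (t * q)"
    using assms q by (simp add: field_simps) (simp add: q_def algebra_simps power2_eq_square)
  finally show ?thesis unfolding q_def .
qed

text \<open>Replace Gamma(\<alpha> + 1) y^(-\<alpha> - 1) by the integral of t^\<alpha> e^(-t y) and
  swap: the y-integral is a Laplace transform that leaves t^(\<alpha> - 1) / (1 + t^2). Finiteness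
  of the nonnegative integral yields integrability along with the value.\<close>

lemma one_minus_cos_power_integral:
  fixes \<alpha> :: real
  assumes "0 < \<alpha>" "\<alpha> < 2"
  shows "set_integrable lborel {0<..} (\<lambda>y. (1 - cos y) * y powr (- \<alpha> - 1))"
    and "(LINT y:{0<..}|lborel. (1 - cos y) * y powr (- \<alpha> - 1)) = pi / (2 * sin (pi * \<alpha> / 2) * Gamma (\<alpha> + 1))"
proof -
  let ?J = "pi / (2 * sin (pi * \<alpha> / 2))"
  have Gpos: "0 < Gamma (\<alpha> + 1)"
    using assms by (intro Gamma_real_pos) auto
  have J: "(\<integral>\<^sup>+t. ennreal (indicator {0<..} t * (t powr (\<alpha> - 1) / (1 + t\<^sup>2))) \<partial>lborel) = ennreal ?J"
    using rational_power_integral[OF assms] unfolding set_integrable_def set_lebesgue_integral_def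
    by (subst nn_integral_eq_integral) auto
  have "ennreal (Gamma (\<alpha> + 1)) * (\<integral>\<^sup>+y. ennreal (indicator {0<..} y * ((1 - cos y) * y powr (- \<alpha> - 1))) \<partial>lborel)
      = (\<integral>\<^sup>+y. ennreal (Gamma (\<alpha> + 1)) * ennreal (indicator {0<..} y * ((1 - cos y) * y powr (- \<alpha> - 1))) \<partial>lborel)"
    by (intro nn_integral_cmult[symmetric]) auto
  also have "\<dots> = (\<integral>\<^sup>+y. (\<integral>\<^sup>+t. ennreal (indicator {0<..} y * (1 - cos y) * (indicator {0<..} t * (t powr \<alpha> * exp (- (t * y))))) \<partial>lborel) \<partial>lborel)"
  proof (intro nn_integral_cong)
    fix y :: real
    show "ennreal (Gamma (\<alpha> + 1)) * ennreal (indicator {0<..} y * ((1 - cos y) * y powr (- \<alpha> - 1)))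
      = (\<integral>\<^sup>+t. ennreal (indicator {0<..} y * (1 - cos y) * (indicator {0<..} t * (t powr \<alpha> * exp (- (t * y))))) \<partial>lborel)"
    proof (cases "0 < y")
      case True
      have "(\<integral>\<^sup>+t. ennreal (indicator {0<..} y * (1 - cos y) * (indicator {0<..} t * (t powr \<alpha> * exp (- (t * y))))) \<partial>lborel)
          = (\<integral>\<^sup>+t. ennreal (1 - cos y) * ennreal (indicator {0<..} t * (t powr ((\<alpha> + 1) - 1) * exp (- (t * y)))) \<partial>lborel)"
        using True by (intro nn_integral_cong) (simp add: ennreal_mult)
      also have "\<dots> = ennreal (1 - cos y) * ennreal (Gamma (\<alpha> + 1) * y powr (- \<alpha> - 1))"
        using True assms by (subst nn_integral_cmult, simp, subst Gamma_nn_integral_scaled) auto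
      finally show ?thesis
        using True Gpos by (simp add: ennreal_mult less_imp_le mult_ac)
    qed simp
  qed
  also have "\<dots> = (\<integral>\<^sup>+t. (\<integral>\<^sup>+y. ennreal (indicator {0<..} y * (1 - cos y) * (indicator {0<..} t * (t powr \<alpha> * exp (- (t * y))))) \<partial>lborel) \<partial>lborel)"
    by (intro lborel_pair.Fubini') measurable
  also have "\<dots> = (\<integral>\<^sup>+t. ennreal (indicator {0<..} t * (t powr (\<alpha> - 1) / (1 + t\<^sup>2))) \<partial>lborel)"
  proof (intro nn_integral_cong)
    fix t :: real
    show "(\<integral>\<^sup>+y. ennreal (indicator {0<..} y * (1 - cos y) * (indicator {0<..} t * (t powr \<alpha> * exp (- (t * y))))) \<partial>lborel)
      = ennreal (indicator {0<..} t * (t powr (\<alpha> - 1) / (1 + t\<^sup>2)))"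
    proof (cases "0 < t")
      case True
      have "(\<integral>\<^sup>+y. ennreal (indicator {0<..} y * (1 - cos y) * (indicator {0<..} t * (t powr \<alpha> * exp (- (t * y))))) \<partial>lborel)
          = (\<integral>\<^sup>+y. ennreal (t powr \<alpha>) * ennreal (indicator {0<..} y * ((1 - cos y) * exp (- (t * y)))) \<partial>lborel)"
        using True by (intro nn_integral_cong) (simp add: mult_ac flip: ennreal_mult)
      also have "\<dots> = ennreal (t powr \<alpha>) * ennreal (1 / (t * (1 + t\<^sup>2)))"
        using True by (subst nn_integral_cmult, simp, subst Laplace_one_minus_cos_nn_integral) auto
      also have "\<dots> = ennreal (t powr \<alpha> / (t * (1 + t\<^sup>2)))"
        using True by (simp flip: ennreal_mult)
      also have "t powr \<alpha> / (t * (1 + t\<^sup>2)) = t powr (\<alpha> - 1) / (1 + t\<^sup>2)"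
        using True by (simp add: powr_diff)
      finally show ?thesis using True by simp
    qed simp
  qed
  finally have *: "ennreal (Gamma (\<alpha> + 1)) * (\<integral>\<^sup>+y. ennreal (indicator {0<..} y * ((1 - cos y) * y powr (- \<alpha> - 1))) \<partial>lborel) = ennreal ?J"
    unfolding J .
  have s: "0 < sin (pi * \<alpha> / 2)"
    using assms by (intro sin_gt_zero) (auto simp: field_simps)
  have "(\<integral>\<^sup>+y. ennreal (indicator {0<..} y * ((1 - cos y) * y powr (- \<alpha> - 1))) \<partial>lborel)
      = ennreal (1 / Gamma (\<alpha> + 1)) * (ennreal (Gamma (\<alpha> + 1)) * (\<integral>\<^sup>+y. ennreal (indicator {0<..} y * ((1 - cos y) * y powr (- \<alpha> - 1))) \<partial>lborel))"
    using Gpos by (simp add: mult.assoc[symmetric] flip: ennreal_mult)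
  also have "\<dots> = ennreal (1 / Gamma (\<alpha> + 1) * ?J)"
    unfolding * using Gpos s by (simp flip: ennreal_mult)
  finally have nn: "(\<integral>\<^sup>+y. ennreal (indicator {0<..} y * ((1 - cos y) * y powr (- \<alpha> - 1))) \<partial>lborel)
      = ennreal (pi / (2 * sin (pi * \<alpha> / 2) * Gamma (\<alpha> + 1)))"
    by (simp add: field_simps)
  have "has_bochner_integral lborel (\<lambda>y. indicator {0<..} y * ((1 - cos y) * y powr (- \<alpha> - 1)))
      (pi / (2 * sin (pi * \<alpha> / 2) * Gamma (\<alpha> + 1)))"
    using Gpos s by (intro has_bochner_integral_nn_integral nn) (auto simp: less_imp_le)
  then show "set_integrable lborel {0<..} (\<lambda>y. (1 - cos y) * y powr (- \<alpha> - 1))"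
    and "(LINT y:{0<..}|lborel. (1 - cos y) * y powr (- \<alpha> - 1)) = pi / (2 * sin (pi * \<alpha> / 2) * Gamma (\<alpha> + 1))"
    unfolding set_integrable_def set_lebesgue_integral_def
    by (auto simp: has_bochner_integral_iff)
qed

text \<open>Integration by parts: (1 - cos y) y^(-\<alpha> - 1) vanishes at both ends because
  \<alpha> < 1, and what remains is \<alpha> + 1 times the cosine integral of index \<alpha> + 1,
  still below 2. The factor \<alpha> + 1 is absorbed by \<open>Gamma\<close>.\<close>

lemma sin_power_integral_less_1:
  fixes \<alpha> :: real
  assumes "0 < \<alpha>" "\<alpha> < 1"
  shows "set_integrable lborel {0<..} (\<lambda>y. sin y * y powr (- \<alpha> - 1))"
    and "(LINT y:{0<..}|lborel. sin y * y powr (- \<alpha> - 1)) = pi / (2 * cos (pi * \<alpha> / 2) * Gamma (\<alpha> + 1))"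
proof -
  have sin_le: "\<bar>sin y\<bar> \<le> y" if "0 < y" for y :: real
    using that abs_sin_x_le_abs_x[of y] by simp
  show I: "set_integrable lborel {0<..} (\<lambda>y. sin y * y powr (- \<alpha> - 1))"
  proof (rule set_integrable_power_bounds[where p = "- \<alpha>" and q = "- \<alpha> - 1" and C = 1])
    fix y :: real assume "0 < y"
    then show "norm (sin y * y powr (- \<alpha> - 1)) \<le> 1 * y powr (- \<alpha>)"
      using mult_right_mono[OF sin_le, of y "y powr (- \<alpha> - 1)"] powr_add[of y 1 "- \<alpha> - 1"] by (simp add: abs_mult)
  next
    fix y :: real assume "1 < y"
    then show "norm (sin y * y powr (- \<alpha> - 1)) \<le> 1 * y powr (- \<alpha> - 1)"
      by (simp add: abs_mult mult_left_le_one_le)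
  qed (use assms in auto)
  have C: "set_integrable lborel {0<..} (\<lambda>y. (1 - cos y) * y powr (- (\<alpha> + 1) - 1))"
    "(LINT y:{0<..}|lborel. (1 - cos y) * y powr (- (\<alpha> + 1) - 1))
      = pi / (2 * sin (pi * (\<alpha> + 1) / 2) * Gamma (\<alpha> + 1 + 1))"
    using one_minus_cos_power_integral[of "\<alpha> + 1"] assms by auto
  let ?F = "\<lambda>y. (1 - cos y) * y powr (- \<alpha> - 1)"
  let ?f = "\<lambda>y. sin y * y powr (- \<alpha> - 1) - (\<alpha> + 1) * ((1 - cos y) * y powr (- (\<alpha> + 1) - 1))"
  have f: "set_integrable lborel {0<..} ?f"
    using I C(1) by (intro set_integral_diff) auto
  have "(LBINT y=0..\<infinity>. ?f y) = 0 - 0"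
  proof (rule interval_integral_FTC_integrable[where F = ?F])
    fix y :: real assume "0 < ereal y"
    then have y: "0 < y" by simp
    show "(?F has_vector_derivative ?f y) (at y)"
      unfolding has_real_derivative_iff_has_vector_derivative[symmetric]
      using y by (auto intro!: derivative_eq_intros) (simp add: algebra_simps)
    show "isCont ?f y"
      using y by (intro continuous_intros) auto
  next
    show "set_integrable lborel (einterval 0 \<infinity>) ?f"
      using f by (simp add: zero_ereal_def)
    have "((\<lambda>y. (1 - cos y) * y powr (- \<alpha> - 1)) \<longlongrightarrow> 0) (at_right 0)"
      using assms by real_asymp
    then show "((?F \<circ> real_of_ereal) \<longlongrightarrow> 0) (at_right 0)"
      by (simp add: zero_ereal_def ereal_tendsto_simps)
    have "((\<lambda>y. (1 - cos y) * y powr (- \<alpha> - 1)) \<longlongrightarrow> 0) at_top"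
    proof (rule Lim_null_comparison[where g = "\<lambda>y. 2 * y powr (- \<alpha> - 1)"])
      show "\<forall>\<^sub>F y in at_top. norm ((1 - cos y) * y powr (- \<alpha> - 1)) \<le> 2 * y powr (- \<alpha> - 1)"
      proof (intro always_eventually allI)
        fix y :: real
        have "\<bar>1 - cos y\<bar> \<le> 2" using cos_ge_minus_one[of y] cos_le_one[of y] by linarith
        then show "norm ((1 - cos y) * y powr (- \<alpha> - 1)) \<le> 2 * y powr (- \<alpha> - 1)"
          by (simp add: abs_mult mult_right_mono)
      qed
      show "((\<lambda>y. 2 * y powr (- \<alpha> - 1)) \<longlongrightarrow> 0) at_top"
        using assms by real_asymp
    qed
    then show "((?F \<circ> real_of_ereal) \<longlongrightarrow> 0) (at_left \<infinity>)"
      by (simp add: ereal_tendsto_simps)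
  qed simp
  then have "(LINT y:{0<..}|lborel. ?f y) = 0"
    by (simp add: interval_lebesgue_integral_0_infty)
  then have "(LINT y:{0<..}|lborel. sin y * y powr (- \<alpha> - 1))
      = (\<alpha> + 1) * (pi / (2 * sin (pi * (\<alpha> + 1) / 2) * Gamma (\<alpha> + 1 + 1)))"
    using I C by (subst (asm) set_integral_diff) auto
  moreover have "sin (pi * (\<alpha> + 1) / 2) = cos (pi * \<alpha> / 2)"
    using sin_add[of "pi * \<alpha> / 2" "pi / 2"] by (simp add: field_simps)
  moreover have "Gamma (\<alpha> + 1 + 1) = (\<alpha> + 1) * Gamma (\<alpha> + 1)"
    using assms by (intro Gamma_plus1) (auto dest!: nonpos_Ints_nonpos)
  ultimately show "(LINT y:{0<..}|lborel. sin y * y powr (- \<alpha> - 1)) = pi / (2 * cos (pi * \<alpha> / 2) * Gamma (\<alpha> + 1))"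
    using assms by simp
qed

lemma abs_sin_minus_self_le:
  fixes y :: real
  shows "\<bar>sin y - y\<bar> \<le> y\<^sup>2 / 2"
  using iexp_approx1[of y 1] abs_Im_le_cmod[of "iexp y - (\<Sum>k\<le>1. (\<i> * y) ^ k / fact k)"]
  by (simp add: Im_exp numeral_2_eq_2)

text \<open>Above index 1 the sine has to be compensated by y near 0. Parts with (sin y - y)
  y^(-\<alpha>) now lower the index to \<alpha> - 1. The closed form is the one found below 1; it is
  negative here since cos (\<pi>\<alpha>/2) is.\<close>

lemma sin_power_integral_greater_1:
  fixes \<alpha> :: real
  assumes "1 < \<alpha>" "\<alpha> < 2"
  shows "set_integrable lborel {0<..} (\<lambda>y. (sin y - y) * y powr (- \<alpha> - 1))"
    and "(LINT y:{0<..}|lborel. (sin y - y) * y powr (- \<alpha> - 1)) = pi / (2 * cos (pi * \<alpha> / 2) * Gamma (\<alpha> + 1))"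
proof -
  have le1: "\<bar>(sin y - y) * y powr (- \<alpha> - 1)\<bar> \<le> 2 * y powr (1 - \<alpha>)" if "0 < y" for y :: real
  proof -
    have "\<bar>(sin y - y) * y powr (- \<alpha> - 1)\<bar> \<le> y\<^sup>2 / 2 * y powr (- \<alpha> - 1)"
      using mult_right_mono[OF abs_sin_minus_self_le, of "y powr (- \<alpha> - 1)" y] by (simp add: abs_mult)
    also have "\<dots> = 1 / 2 * y powr (1 - \<alpha>)"
      using that powr_add[of y 2 "- \<alpha> - 1"] by simp
    finally show ?thesis
      using powr_ge_zero[of y "1 - \<alpha>"] by linarith
  qed
  have le2: "\<bar>(sin y - y) * y powr (- \<alpha> - 1)\<bar> \<le> 2 * y powr (- \<alpha>)" if "0 < y" for y :: real
  proof -
    have "\<bar>sin y - y\<bar> \<le> 2 * y"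
      using that abs_sin_x_le_abs_x[of y] by simp
    then have "\<bar>(sin y - y) * y powr (- \<alpha> - 1)\<bar> \<le> 2 * y * y powr (- \<alpha> - 1)"
      by (simp add: abs_mult mult_right_mono)
    also have "\<dots> = 2 * y powr (- \<alpha>)"
      using that powr_add[of y 1 "- \<alpha> - 1"] by simp
    finally show ?thesis .
  qed
  show I: "set_integrable lborel {0<..} (\<lambda>y. (sin y - y) * y powr (- \<alpha> - 1))"
    by (rule set_integrable_power_bounds[where p = "1 - \<alpha>" and q = "- \<alpha>" and C = 2])
      (use assms le1 le2 in auto)
  have C: "set_integrable lborel {0<..} (\<lambda>y. (1 - cos y) * y powr (- (\<alpha> - 1) - 1))"
    "(LINT y:{0<..}|lborel. (1 - cos y) * y powr (- (\<alpha> - 1) - 1))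
      = pi / (2 * sin (pi * (\<alpha> - 1) / 2) * Gamma (\<alpha> - 1 + 1))"
    using one_minus_cos_power_integral[of "\<alpha> - 1"] assms by auto
  let ?F = "\<lambda>y. (sin y - y) * y powr (- \<alpha>)"
  let ?f = "\<lambda>y. - ((1 - cos y) * y powr (- (\<alpha> - 1) - 1)) - \<alpha> * ((sin y - y) * y powr (- \<alpha> - 1))"
  have f: "set_integrable lborel {0<..} ?f"
    using I C(1) by (intro set_integral_diff set_integrable_mult_right) (auto simp: set_integrable_def)
  have "(LBINT y=0..\<infinity>. ?f y) = 0 - 0"
  proof (rule interval_integral_FTC_integrable[where F = ?F])
    fix y :: real assume "0 < ereal y"
    then have y: "0 < y" by simp
    show "(?F has_vector_derivative ?f y) (at y)"
      unfolding has_real_derivative_iff_has_vector_derivative[symmetric]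
      using y by (auto intro!: derivative_eq_intros) (simp add: algebra_simps)
    show "isCont ?f y"
      using y by (intro continuous_intros) auto
  next
    show "set_integrable lborel (einterval 0 \<infinity>) ?f"
      using f by (simp add: zero_ereal_def)
    have "((\<lambda>y. (sin y - y) * y powr (- \<alpha>)) \<longlongrightarrow> 0) (at_right 0)"
      using assms by real_asymp
    then show "((?F \<circ> real_of_ereal) \<longlongrightarrow> 0) (at_right 0)"
      by (simp add: zero_ereal_def ereal_tendsto_simps)
    have "((\<lambda>y. (sin y - y) * y powr (- \<alpha>)) \<longlongrightarrow> 0) at_top"
    proof (rule Lim_null_comparison[where g = "\<lambda>y. 2 * y powr (1 - \<alpha>)"])
      show "\<forall>\<^sub>F y in at_top. norm ((sin y - y) * y powr (- \<alpha>)) \<le> 2 * y powr (1 - \<alpha>)"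
        using eventually_gt_at_top[of 0]
      proof eventually_elim
        fix y :: real assume y: "0 < y"
        have "y powr (- \<alpha>) = y * y powr (- \<alpha> - 1)" "y powr (1 - \<alpha>) = y * y powr (- \<alpha>)"
          using y powr_add[of y 1 "- \<alpha> - 1"] powr_add[of y 1 "- \<alpha>"] by simp_all
        then show "norm ((sin y - y) * y powr (- \<alpha>)) \<le> 2 * y powr (1 - \<alpha>)"
          using mult_left_mono[OF le2[OF y], of y] y by (simp add: abs_mult mult_ac)
      qed
      show "((\<lambda>y. 2 * y powr (1 - \<alpha>)) \<longlongrightarrow> 0) at_top"
        using assms by real_asymp
    qed
    then show "((?F \<circ> real_of_ereal) \<longlongrightarrow> 0) (at_left \<infinity>)"
      by (simp add: ereal_tendsto_simps)
  qed simp
  then have "(LINT y:{0<..}|lborel. ?f y) = 0"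
    by (simp add: interval_lebesgue_integral_0_infty)
  moreover have "(LINT y:{0<..}|lborel. ?f y)
      = - (LINT y:{0<..}|lborel. (1 - cos y) * y powr (- (\<alpha> - 1) - 1))
        - \<alpha> * (LINT y:{0<..}|lborel. (sin y - y) * y powr (- \<alpha> - 1))"
  proof -
    have "set_integrable lborel {0<..} (\<lambda>y. - ((1 - cos y) * y powr (- (\<alpha> - 1) - 1)))"
      "set_integrable lborel {0<..} (\<lambda>y. \<alpha> * ((sin y - y) * y powr (- \<alpha> - 1)))"
      using C(1) set_integrable_mult_right[OF I, of \<alpha>] by (simp_all add: set_integrable_def)
    from set_integral_diff(2)[OF this] show ?thesis
      by (simp only: set_integral_uminus[OF C(1)] set_integral_mult_right)
  qed
  moreover have "S * a = - K" if "- K - a * S = 0" for S a K :: real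
    using that by (simp add: algebra_simps)
  ultimately have "(LINT y:{0<..}|lborel. (sin y - y) * y powr (- \<alpha> - 1)) * \<alpha>
      = - (pi / (2 * sin (pi * (\<alpha> - 1) / 2) * Gamma (\<alpha> - 1 + 1)))"
    unfolding C(2) by presburger
  then have "(LINT y:{0<..}|lborel. (sin y - y) * y powr (- \<alpha> - 1))
      = - (pi / (2 * sin (pi * (\<alpha> - 1) / 2) * Gamma (\<alpha> - 1 + 1))) / \<alpha>"
    by (rule eq_divide_imp[rotated]) (use assms in simp)
  moreover have "sin (pi * (\<alpha> - 1) / 2) = - cos (pi * \<alpha> / 2)"
    using sin_diff[of "pi * \<alpha> / 2" "pi / 2"] by (simp add: field_simps)
  moreover have "Gamma (\<alpha> + 1) = \<alpha> * Gamma \<alpha>"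
    using assms by (intro Gamma_plus1) (auto dest!: nonpos_Ints_nonpos)
  ultimately show "(LINT y:{0<..}|lborel. (sin y - y) * y powr (- \<alpha> - 1)) = pi / (2 * cos (pi * \<alpha> / 2) * Gamma (\<alpha> + 1))"
    using assms by simp
qed

section \<open>Characteristic functions\<close>

text \<open>Both sides are the double integral of e^(i s u y), which is symmetric in the two
  measures.\<close>

lemma char_Parseval:
  assumes "real_distribution M" "real_distribution N"
  shows "(CLINT u|N. char M (s * u)) = (CLINT y|M. char N (s * y))"
proof -
  interpret M: real_distribution M by fact
  interpret N: real_distribution N by fact
  interpret pair_sigma_finite M N ..
  interpret P: prob_space "M \<Otimes>\<^sub>M N"
    by (rule prob_space_pair) unfold_locales
  have "integrable (M \<Otimes>\<^sub>M N) (\<lambda>(y, u). iexp (s * u * y))"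
    by (rule P.integrable_const_bound[of _ 1]) (auto simp: split_beta)
  from Fubini_integral[OF this] show ?thesis
    unfolding char_def by (simp add: mult_ac)
qed

text \<open>The Gaussian is its own Fourier transform, so averages of \<open>char M\<close> become
  expectations of a positive bump. Large s isolates the atom at 0, and s = 1 controls the
  tail.\<close>

lemma (in real_distribution) gaussian_smoothing:
  "(CLINT u|std_normal_distribution. char M (s * u)) = complex_of_real (LINT y|M. exp (- (s * y)\<^sup>2 / 2))"
proof -
  have "(CLINT u|std_normal_distribution. char M (s * u)) = (CLINT y|M. char std_normal_distribution (s * y))"
    by (intro char_Parseval real_dist_normal_dist) unfold_locales
  also have "\<dots> = (CLINT y|M. complex_of_real (exp (- (s * y)\<^sup>2 / 2)))"
    by (simp add: char_std_normal_distribution)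
  also have "\<dots> = complex_of_real (LINT y|M. exp (- (s * y)\<^sup>2 / 2))"
    by (rule integral_complex_of_real)
  finally show ?thesis .
qed

text \<open>Take s = n in \<open>gaussian_smoothing\<close>: the bump dominates the indicator of {0}
  for every n, while n u leaves every bounded set for almost all u. This rules out the mass at 0,
  which the Gil-Pelaez formula does not see.\<close>

lemma (in real_distribution) atom_zero_of_char_vanishing:
  assumes "(char M \<longlongrightarrow> 0) at_top" "(char M \<longlongrightarrow> 0) at_bot"
  shows "measure M {0} = 0"
proof -
  interpret N: real_distribution std_normal_distribution
    by (rule real_dist_normal_dist)
  have "(\<lambda>n. CLINT u|std_normal_distribution. char M (real n * u)) \<longlonglongrightarrow> (CLINT u|std_normal_distribution. 0)"
  proof (rule integral_dominated_convergence[where w = "\<lambda>_. 1"])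
    have "AE u in std_normal_distribution. u \<noteq> 0"
      using AE_lborel_singleton[of 0] by (subst AE_density) auto
    then show "AE u in std_normal_distribution. (\<lambda>n. char M (real n * u)) \<longlonglongrightarrow> 0"
    proof (rule AE_mp, intro AE_I2 impI)
      fix u :: real assume "u \<noteq> 0"
      show "(\<lambda>n. char M (real n * u)) \<longlonglongrightarrow> 0"
      proof (cases "0 < u")
        case True
        then have "filterlim (\<lambda>n. real n * u) at_top sequentially"
          by real_asymp
        then show ?thesis by (rule filterlim_compose[OF assms(1)])
      next
        case False
        with \<open>u \<noteq> 0\<close> have "u < 0" by simp
        then have "filterlim (\<lambda>n. real n * u) at_bot sequentially"
          by real_asymp
        then show ?thesis by (rule filterlim_compose[OF assms(2)])
      qed
    qed
  qed (auto simp: cmod_char_le_1)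
  then have "(\<lambda>n. complex_of_real (LINT y|M. exp (- (real n * y)\<^sup>2 / 2))) \<longlonglongrightarrow> 0"
    by (simp add: gaussian_smoothing)
  from tendsto_Re[OF this] have "(\<lambda>n. LINT y|M. exp (- (real n * y)\<^sup>2 / 2)) \<longlonglongrightarrow> 0"
    by simp
  moreover have "measure M {0} \<le> (LINT y|M. exp (- (real n * y)\<^sup>2 / 2))" for n
  proof -
    have "measure M {0} = (LINT y|M. indicator {0} y)"
      by simp
    also have "\<dots> \<le> (LINT y|M. exp (- (real n * y)\<^sup>2 / 2))"
      by (intro integral_mono integrable_const_bound[of _ 1]) (auto simp: indicator_def)
    finally show ?thesis .
  qed
  ultimately have "measure M {0} \<le> 0"
    by (intro tendsto_lowerbound[of _ 0 sequentially]) auto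
  then show ?thesis by (simp add: measure_le_0_iff)
qed

text \<open>sin (u y) / u is not absolutely integrable over the half-line, so Fubini is applied on a
  bounded interval away from 0, where the inner integral is a difference of values of
  \<open>Si\<close>. As \<open>Si\<close> is bounded and tends to \<pi>/2, dominated convergence
  gives (\<pi>/2) sgn y, and an atom at 0 drops out because sgn 0 = 0.\<close>

lemma (in real_distribution) Gil_Pelaez_zero:
  assumes "set_integrable lborel {0<..} (\<lambda>u. Im (char M u) / u)"
  shows "(LINT u:{0<..}|lborel. Im (char M u) / u) = pi / 2 * (measure M {0<..} - measure M {..<0})"
proof -
  define e T where "e n = inverse (real (Suc n))" and "T n = real n + 2" for n :: nat
  have eT: "0 < e n" "e n < T n" for n
  proof -
    have "e n \<le> 1" by (simp add: e_def field_simps)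
    then show "0 < e n" "e n < T n" by (auto simp: e_def T_def)
  qed
  obtain B where B: "\<And>t. \<bar>Si t\<bar> \<le> B" using bounded_Si by blast
  interpret pair_sigma_finite M lborel ..
  have Im_char: "Im (char M u) = (LINT y|M. sin (u * y))" for u
    unfolding char_def
    by (subst integral_Im[symmetric]) (auto simp: Im_exp intro!: integrable_const_bound[of _ 1])
  have eq: "(LINT u:{e n<..<T n}|lborel. Im (char M u) / u) = (LINT y|M. sgn y * (Si (T n * \<bar>y\<bar>) - Si (e n * \<bar>y\<bar>)))" for n
  proof -
    have "integrable (M \<Otimes>\<^sub>M lborel) (\<lambda>(y, u). indicator {e n<..<T n} u * (sin (u * y) / u))"
    proof (rule Fubini_integrable)
      have bound: "norm (indicator {e n<..<T n} u * (sin (u * y) / u)) \<le> indicator {e n<..<T n} u * inverse (e n)" for u y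
      proof (cases "u \<in> {e n<..<T n}")
        case True
        then have "0 < u" using eT(1)[of n] by auto
        have "\<bar>sin (u * y)\<bar> / u \<le> 1 / u"
          using \<open>0 < u\<close> by (intro divide_right_mono) auto
        also have "\<dots> \<le> inverse (e n)"
          using True eT(1)[of n] by (simp add: field_simps)
        finally show ?thesis using True \<open>0 < u\<close> by (simp add: abs_mult)
      qed simp
      have int: "integrable lborel (\<lambda>u. indicator {e n<..<T n} u * inverse (e n))"
        using eT(2)[of n] by (intro integrable_mult_left) (simp add: integrable_indicator_iff less_imp_le)
      have intF: "integrable lborel (\<lambda>u. indicator {e n<..<T n} u * (sin (u * y) / u))" for y
      proof (rule Bochner_Integration.integrable_bound[OF int])
        show "AE u in lborel. norm (indicator {e n<..<T n} u * (sin (u * y) / u)) \<le> norm (indicator {e n<..<T n} u * inverse (e n))"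
          by (intro AE_I2 order_trans[OF bound]) simp
      qed measurable
      then show "AE y in M. integrable lborel (\<lambda>u. case (y, u) of (y, u) \<Rightarrow> indicator {e n<..<T n} u * (sin (u * y) / u))"
        by simp
      show "integrable M (\<lambda>y. LINT u|lborel. norm (case (y, u) of (y, u) \<Rightarrow> indicator {e n<..<T n} u * (sin (u * y) / u)))"
      proof (rule integrable_const_bound[of _ "LINT u|lborel. indicator {e n<..<T n} u * inverse (e n)"], intro AE_I2)
        fix y
        have "(LINT u|lborel. norm (indicator {e n<..<T n} u * (sin (u * y) / u)))
            \<le> (LINT u|lborel. indicator {e n<..<T n} u * inverse (e n))"
          by (intro integral_mono integrable_norm intF int bound)
        then show "norm (LINT u|lborel. norm (case (y, u) of (y, u) \<Rightarrow> indicator {e n<..<T n} u * (sin (u * y) / u)))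
            \<le> (LINT u|lborel. indicator {e n<..<T n} u * inverse (e n))"
          by (simp add: integral_nonneg_AE)
      qed measurable
    qed measurable
    from Fubini_integral[OF this]
    have "(LINT u|lborel. LINT y|M. indicator {e n<..<T n} u * (sin (u * y) / u))
        = (LINT y|M. LINT u|lborel. indicator {e n<..<T n} u * (sin (u * y) / u))" .
    moreover have "(LINT y|M. indicator {e n<..<T n} u * (sin (u * y) / u)) = indicator {e n<..<T n} u *\<^sub>R (Im (char M u) / u)" for u
      by (simp add: Im_char)
    moreover have "(LINT u|lborel. indicator {e n<..<T n} u * (sin (u * y) / u)) = sgn y * (Si (T n * \<bar>y\<bar>) - Si (e n * \<bar>y\<bar>))" for y
    proof -
      have "(LBINT u=0..e n. sin (u * y) / u) + (LBINT u=e n..T n. sin (u * y) / u) = (LBINT u=0..T n. sin (u * y) / u)"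
        using integrable_sinc'[of "T n" y] eT[of n]
        by (intro interval_integral_sum) (simp add: min_def max_def zero_ereal_def)
      moreover have "(LBINT u=0..e n. sin (u * y) / u) = sgn y * Si (e n * \<bar>y\<bar>)"
        "(LBINT u=0..T n. sin (u * y) / u) = sgn y * Si (T n * \<bar>y\<bar>)"
        using LBINT_I0c_sin_scale_divide eT[of n] by auto
      ultimately have "(LBINT u=e n..T n. sin (u * y) / u) = sgn y * (Si (T n * \<bar>y\<bar>) - Si (e n * \<bar>y\<bar>))"
        by (simp add: algebra_simps)
      then show ?thesis
        using eT[of n] by (simp add: interval_lebesgue_integral_le_eq set_lebesgue_integral_def)
    qed
    ultimately show ?thesis
      unfolding set_lebesgue_integral_def by (simp only:)
  qed
  have e0: "e \<longlonglongrightarrow> 0" unfolding e_def by (rule LIMSEQ_inverse_real_of_nat)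
  have Tinf: "filterlim T at_top sequentially" unfolding T_def by real_asymp
  have "(\<lambda>n. LINT y|M. sgn y * (Si (T n * \<bar>y\<bar>) - Si (e n * \<bar>y\<bar>))) \<longlonglongrightarrow> (LINT y|M. sgn y * (pi / 2))"
  proof (rule integral_dominated_convergence[where w = "\<lambda>_. 2 * B"])
    show "AE y in M. (\<lambda>n. sgn y * (Si (T n * \<bar>y\<bar>) - Si (e n * \<bar>y\<bar>))) \<longlonglongrightarrow> sgn y * (pi / 2)"
    proof (intro AE_I2)
      fix y
      show "(\<lambda>n. sgn y * (Si (T n * \<bar>y\<bar>) - Si (e n * \<bar>y\<bar>))) \<longlonglongrightarrow> sgn y * (pi / 2)"
      proof (cases "y = 0")
        case False
        have "filterlim (\<lambda>n. T n * \<bar>y\<bar>) at_top sequentially"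
          using False Tinf by (intro filterlim_at_top_mult_tendsto_pos[OF tendsto_const]) auto
        then have 1: "(\<lambda>n. Si (T n * \<bar>y\<bar>)) \<longlonglongrightarrow> pi / 2"
          by (rule filterlim_compose[OF Si_at_top])
        have "(\<lambda>n. e n * \<bar>y\<bar>) \<longlonglongrightarrow> 0" using tendsto_mult_left_zero[OF e0] .
        then have 2: "(\<lambda>n. Si (e n * \<bar>y\<bar>)) \<longlonglongrightarrow> Si 0"
          by (rule isCont_tendsto_compose[OF isCont_Si])
        have "Si 0 = 0" by (simp add: Si_def zero_ereal_def)
        with tendsto_mult[OF tendsto_const tendsto_diff[OF 1 2], of "sgn y"] show ?thesis by simp
      qed simp
    qed
    show "AE y in M. norm (sgn y * (Si (T n * \<bar>y\<bar>) - Si (e n * \<bar>y\<bar>))) \<le> 2 * B" for n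
    proof (intro AE_I2)
      fix y
      have "\<bar>Si (T n * \<bar>y\<bar>) - Si (e n * \<bar>y\<bar>)\<bar> \<le> 2 * B"
        using B[of "T n * \<bar>y\<bar>"] B[of "e n * \<bar>y\<bar>"] by linarith
      then show "norm (sgn y * (Si (T n * \<bar>y\<bar>) - Si (e n * \<bar>y\<bar>))) \<le> 2 * B"
        by (auto simp: abs_mult sgn_if)
    qed
  qed auto
  then have 1: "(\<lambda>n. LINT u:{e n<..<T n}|lborel. Im (char M u) / u) \<longlonglongrightarrow> (LINT y|M. sgn y * (pi / 2))"
    by (simp only: eq)
  have 2: "(\<lambda>n. LINT u:{e n<..<T n}|lborel. Im (char M u) / u) \<longlonglongrightarrow> (LINT u:{0<..}|lborel. Im (char M u) / u)"
    unfolding set_lebesgue_integral_def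
  proof (rule integral_dominated_convergence[where w = "\<lambda>u. norm (indicator {0<..} u *\<^sub>R (Im (char M u) / u))"])
    show "integrable lborel (\<lambda>u. norm (indicator {0<..} u *\<^sub>R (Im (char M u) / u)))"
      using assms by (intro integrable_norm) (simp add: set_integrable_def)
    show "AE u in lborel. norm (indicator {e n<..<T n} u *\<^sub>R (Im (char M u) / u)) \<le> norm (indicator {0<..} u *\<^sub>R (Im (char M u) / u))" for n
      using eT(1)[of n] by (intro AE_I2) (auto simp: indicator_def)
    show "AE u in lborel. (\<lambda>n. indicator {e n<..<T n} u *\<^sub>R (Im (char M u) / u)) \<longlonglongrightarrow> indicator {0<..} u *\<^sub>R (Im (char M u) / u)"
    proof (intro AE_I2 tendsto_eventually)
      fix u :: real
      show "\<forall>\<^sub>F n in sequentially. indicator {e n<..<T n} u *\<^sub>R (Im (char M u) / u) = indicator {0<..} u *\<^sub>R (Im (char M u) / u)"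
      proof (cases "0 < u")
        case True
        from order_tendstoD(2)[OF e0 True] filterlim_at_top_dense[THEN iffD1, OF Tinf, rule_format, of u]
        show ?thesis by eventually_elim (use True in auto)
      next
        case False
        then show ?thesis
          using eT(1) by (intro always_eventually allI) (auto simp: indicator_def dest: less_trans)
      qed
    qed
  qed measurable
  have "(LINT y|M. sgn y * (pi / 2)) = (LINT y|M. (indicator {0<..} y - indicator {..<0} y) * (pi / 2))"
    by (intro Bochner_Integration.integral_cong) (auto simp: indicator_def sgn_if)
  also have "\<dots> = pi / 2 * (measure M {0<..} - measure M {..<0})"
  proof -
    have "integrable M (indicator {0<..} :: real \<Rightarrow> real)" "integrable M (indicator {..<0} :: real \<Rightarrow> real)"
      by (auto intro!: integrable_const_bound[of _ 1])
    from Bochner_Integration.integral_diff[OF this] show ?thesis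
      by simp
  qed
  finally show ?thesis
    using LIMSEQ_unique[OF 1 2] by (simp only:)
qed

section \<open>Damped sine integrals and the arctangent\<close>

lemma Laplace_cos_integral:
  fixes A b :: real
  assumes "0 < A"
  shows "set_integrable lborel {0<..} (\<lambda>v. exp (- (A * v)) * cos (b * v))"
    and "(LINT v:{0<..}|lborel. exp (- (A * v)) * cos (b * v)) = A / (A\<^sup>2 + b\<^sup>2)"
proof -
  have E: "set_integrable lborel {0<..} (\<lambda>v. exp (- (A * v)))"
    using integrable_I0i_exp_mscale[OF assms] by (simp add: mult.commute)
  have "norm (exp (- (A * v)) * cos (b * v)) \<le> norm (exp (- (A * v)))" for v
    by (simp add: abs_mult mult_left_le)
  then show I: "set_integrable lborel {0<..} (\<lambda>v. exp (- (A * v)) * cos (b * v))"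
    by (intro set_integrable_bound[OF E]) (auto simp: set_borel_measurable_def)
  define q where "q = A\<^sup>2 + b\<^sup>2"
  have q: "0 < q" using assms by (simp add: q_def add_pos_nonneg)
  let ?F = "\<lambda>v. exp (- (A * v)) * (b * sin (b * v) - A * cos (b * v)) / q"
  have "(LBINT v=0..\<infinity>. exp (- (A * v)) * cos (b * v)) = 0 - (- A / q)"
  proof (rule interval_integral_FTC_integrable[where F = ?F])
    fix v :: real
    have "(?F has_real_derivative (- A * exp (- (A * v)) * (b * sin (b * v) - A * cos (b * v))
        + exp (- (A * v)) * (b * (b * cos (b * v)) + A * (b * sin (b * v)))) / q) (at v)"
      using q by (auto intro!: derivative_eq_intros)
    moreover have "- A * exp (- (A * v)) * (b * sin (b * v) - A * cos (b * v))
        + exp (- (A * v)) * (b * (b * cos (b * v)) + A * (b * sin (b * v))) = q * (exp (- (A * v)) * cos (b * v))"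
      by (simp add: q_def algebra_simps power2_eq_square)
    ultimately show "(?F has_vector_derivative exp (- (A * v)) * cos (b * v)) (at v)"
      unfolding has_real_derivative_iff_has_vector_derivative[symmetric] using q by simp
    show "isCont (\<lambda>v. exp (- (A * v)) * cos (b * v)) v"
      by (intro continuous_intros)
  next
    show "set_integrable lborel (einterval 0 \<infinity>) (\<lambda>v. exp (- (A * v)) * cos (b * v))"
      using I by (simp add: zero_ereal_def)
    have "isCont ?F 0" using q by (intro continuous_intros) auto
    then have "(?F \<longlongrightarrow> - A / q) (at 0)" by (simp add: isCont_def)
    then have "(?F \<longlongrightarrow> - A / q) (at_right 0)" by (simp add: filterlim_at_split)
    then show "((?F \<circ> real_of_ereal) \<longlongrightarrow> - A / q) (at_right 0)"
      by (simp add: zero_ereal_def ereal_tendsto_simps)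
    have "(?F \<longlongrightarrow> 0) at_top"
    proof (rule Lim_null_comparison[where g = "\<lambda>v. exp (- (A * v)) * ((\<bar>b\<bar> + A) / q)"])
      have "norm (?F v) \<le> exp (- (A * v)) * ((\<bar>b\<bar> + A) / q)" for v
      proof -
        have "\<bar>b * sin (b * v) - A * cos (b * v)\<bar> \<le> \<bar>b\<bar> * \<bar>sin (b * v)\<bar> + A * \<bar>cos (b * v)\<bar>"
          using assms abs_triangle_ineq4[of "b * sin (b * v)" "A * cos (b * v)"] by (simp add: abs_mult)
        also have "\<dots> \<le> \<bar>b\<bar> * 1 + A * 1"
          using assms by (intro add_mono mult_left_mono) auto
        finally show ?thesis
          using q by (simp add: abs_mult divide_right_mono)
      qed
      then show "\<forall>\<^sub>F v in at_top. norm (?F v) \<le> exp (- (A * v)) * ((\<bar>b\<bar> + A) / q)"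
        by (intro always_eventually allI)
      have "((\<lambda>v. exp (- (A * v))) \<longlongrightarrow> 0) at_top"
        using assms by real_asymp
      then show "((\<lambda>v. exp (- (A * v)) * ((\<bar>b\<bar> + A) / q)) \<longlongrightarrow> 0) at_top"
        by (rule tendsto_mult_left_zero)
    qed
    then show "((?F \<circ> real_of_ereal) \<longlongrightarrow> 0) (at_left \<infinity>)"
      by (simp add: ereal_tendsto_simps)
  qed simp
  then show "(LINT v:{0<..}|lborel. exp (- (A * v)) * cos (b * v)) = A / (A\<^sup>2 + b\<^sup>2)"
    by (simp add: interval_lebesgue_integral_0_infty q_def)
qed

text \<open>sin (B v) / v is the integral of cos (b v) over b in [0, B]. After Fubini, justified by
  the majorant e^(-A v) on a strip of width B, the inner integral A / (A^2 + b^2) has the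
  antiderivative arctan (b / A).\<close>

lemma Laplace_sinc_integral_nonneg:
  fixes A B :: real
  assumes "0 < A" "0 \<le> B"
  shows "set_integrable lborel {0<..} (\<lambda>v. exp (- (A * v)) * sin (B * v) / v)"
    and "(LINT v:{0<..}|lborel. exp (- (A * v)) * sin (B * v) / v) = arctan (B / A)"
proof -
  define F where "F v b = indicator {0<..} v * indicator {0..B} b * (exp (- (A * v)) * cos (b * v))" for v b :: real
  have E: "integrable lborel (\<lambda>v. indicator {0<..} v * exp (- (A * v)))"
    using integrable_I0i_exp_mscale[OF assms(1)] by (simp add: mult.commute set_integrable_def)
  have bound: "norm (F v b) \<le> indicator {0..B} b * (indicator {0<..} v * exp (- (A * v)))" for v b
    by (auto simp: F_def indicator_def abs_mult mult_left_le)
  have F_meas: "(\<lambda>(v, b). F v b) \<in> borel_measurable (lborel \<Otimes>\<^sub>M lborel)"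
    unfolding F_def by measurable
  have inner: "(LINT b|lborel. F v b) = indicator {0<..} v *\<^sub>R (exp (- (A * v)) * sin (B * v) / v)" for v
  proof (cases "0 < v")
    case True
    have "(LBINT b=0..ereal B. cos (b * v)) = sin (B * v) / v - sin (0 * v) / v"
      unfolding zero_ereal_def
      using True assms(2) by (intro interval_integral_FTC_finite)
        (auto intro!: continuous_intros derivative_eq_intros simp flip: has_real_derivative_iff_has_vector_derivative)
    then have "(LINT b:{0..B}|lborel. cos (b * v)) = sin (B * v) / v"
      using assms(2) by (simp add: interval_integral_Icc zero_ereal_def)
    moreover have "(LINT b|lborel. F v b) = (LINT b|lborel. exp (- (A * v)) * (indicator {0..B} b *\<^sub>R cos (b * v)))"
      using True unfolding F_def by (intro Bochner_Integration.integral_cong) auto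
    ultimately show ?thesis
      using True by (simp add: set_lebesgue_integral_def)
  qed (simp add: F_def)
  have int: "integrable (lborel \<Otimes>\<^sub>M lborel) (\<lambda>(v, b). F v b)"
  proof (rule lborel_pair.Fubini_integrable[OF F_meas])
    have I: "integrable lborel (\<lambda>b. indicator {0..B} b * (indicator {0<..} v * exp (- (A * v))))" for v :: real
      by (intro integrable_mult_left) (simp add: integrable_indicator_iff emeasure_lborel_Icc_eq)
    have I': "integrable lborel (F v)" for v
    proof (rule Bochner_Integration.integrable_bound[OF I])
      show "F v \<in> borel_measurable lborel" unfolding F_def by measurable
      show "AE b in lborel. norm (F v b) \<le> norm (indicator {0..B} b * (indicator {0<..} v * exp (- (A * v))))"
        by (intro AE_I2 order_trans[OF bound]) simp
    qed
    then show "AE v in lborel. integrable lborel (\<lambda>b. case (v, b) of (v, b) \<Rightarrow> F v b)"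
      by simp
    show "integrable lborel (\<lambda>v. LINT b|lborel. norm (case (v, b) of (v, b) \<Rightarrow> F v b))"
    proof (rule Bochner_Integration.integrable_bound[OF integrable_mult_right[OF E, of B]])
      show "AE v in lborel. norm (LINT b|lborel. norm (case (v, b) of (v, b) \<Rightarrow> F v b)) \<le> norm (B * (indicator {0<..} v * exp (- (A * v))))"
      proof (intro AE_I2)
        fix v
        have "(LINT b|lborel. norm (F v b)) \<le> (LINT b|lborel. indicator {0..B} b * (indicator {0<..} v * exp (- (A * v))))"
          using bound by (intro integral_mono_AE integrable_norm I I') auto
        also have "\<dots> = B * (indicator {0<..} v * exp (- (A * v)))"
          using assms(2) by (simp add: measure_def)
        finally show "norm (LINT b|lborel. norm (case (v, b) of (v, b) \<Rightarrow> F v b)) \<le> norm (B * (indicator {0<..} v * exp (- (A * v))))"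
          using assms(2) by (simp add: integral_nonneg_AE)
      qed
      show "(\<lambda>v. LINT b|lborel. norm (case (v, b) of (v, b) \<Rightarrow> F v b)) \<in> borel_measurable lborel"
        using F_meas by (intro lborel.borel_measurable_lebesgue_integral) (simp add: split_beta)
    qed
  qed
  show "set_integrable lborel {0<..} (\<lambda>v. exp (- (A * v)) * sin (B * v) / v)"
    using lborel_pair.integrable_fst[OF int] unfolding inner set_integrable_def .
  have "(LINT v|lborel. LINT b|lborel. F v b) = (LINT b|lborel. LINT v|lborel. F v b)"
    using lborel_pair.Fubini_integral[OF int] by simp
  also have "\<dots> = (LINT b|lborel. indicator {0..B} b *\<^sub>R (A / (A\<^sup>2 + b\<^sup>2)))"
  proof (intro Bochner_Integration.integral_cong refl)
    fix b
    have "(LINT v|lborel. F v b) = (LINT v|lborel. indicator {0..B} b * (indicator {0<..} v *\<^sub>R (exp (- (A * v)) * cos (b * v))))"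
      unfolding F_def by (intro Bochner_Integration.integral_cong) auto
    also have "\<dots> = indicator {0..B} b * (A / (A\<^sup>2 + b\<^sup>2))"
      using Laplace_cos_integral(2)[OF assms(1), of b] by (simp add: set_lebesgue_integral_def)
    finally show "(LINT v|lborel. F v b) = indicator {0..B} b *\<^sub>R (A / (A\<^sup>2 + b\<^sup>2))" by simp
  qed
  also have "\<dots> = (LBINT b=0..ereal B. A / (A\<^sup>2 + b\<^sup>2))"
    using assms(2) by (simp add: interval_integral_Icc zero_ereal_def set_lebesgue_integral_def)
  also have "\<dots> = arctan (B / A) - arctan (0 / A)"
    unfolding zero_ereal_def
  proof (rule interval_integral_FTC_finite)
    have pos: "0 < A\<^sup>2 + b\<^sup>2" for b using assms(1) by (simp add: add_pos_nonneg)
    show "continuous_on {min 0 B..max 0 B} (\<lambda>b. A / (A\<^sup>2 + b\<^sup>2))"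
      using pos by (intro continuous_intros) (metis less_irrefl)
    fix b
    have "((\<lambda>b. arctan (b / A)) has_real_derivative inverse (1 + (b / A)\<^sup>2) * (1 / A)) (at b within {min 0 B..max 0 B})"
      using assms(1) by (auto intro!: derivative_eq_intros)
    moreover have "inverse (1 + (b / A)\<^sup>2) * (1 / A) = A / (A\<^sup>2 + b\<^sup>2)"
      using assms(1) pos[of b] by (simp add: field_simps power2_eq_square)
    ultimately show "((\<lambda>b. arctan (b / A)) has_vector_derivative A / (A\<^sup>2 + b\<^sup>2)) (at b within {min 0 B..max 0 B})"
      by (simp add: has_real_derivative_iff_has_vector_derivative)
  qed
  finally show "(LINT v:{0<..}|lborel. exp (- (A * v)) * sin (B * v) / v) = arctan (B / A)"
    unfolding inner set_lebesgue_integral_def by simp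
qed

lemma Laplace_sinc_integral:
  fixes A B :: real
  assumes "0 < A"
  shows "set_integrable lborel {0<..} (\<lambda>v. exp (- (A * v)) * sin (B * v) / v)"
    and "(LINT v:{0<..}|lborel. exp (- (A * v)) * sin (B * v) / v) = arctan (B / A)"
proof (atomize(full), cases "0 \<le> B")
  case False
  then have B: "0 \<le> - B" by simp
  note L = Laplace_sinc_integral_nonneg[OF assms B]
  have eq: "exp (- (A * v)) * sin (B * v) / v = - (exp (- (A * v)) * sin (- B * v) / v)" for v
    by simp
  show "set_integrable lborel {0<..} (\<lambda>v. exp (- (A * v)) * sin (B * v) / v) \<and>
    (LINT v:{0<..}|lborel. exp (- (A * v)) * sin (B * v) / v) = arctan (B / A)"
    unfolding eq
    using L(1) set_integral_uminus[OF L(1)] L(2) by (simp add: set_integrable_def arctan_minus)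
qed (use Laplace_sinc_integral_nonneg[OF assms] in auto)

text \<open>Under v = u^\<alpha> the measure dv / v becomes \<alpha> du / u, so the power only costs
  a factor 1 / \<alpha>. This is the Gil-Pelaez integral of a stable law.\<close>

lemma stable_sinc_integral:
  fixes A B \<alpha> :: real
  assumes "0 < A" "0 < \<alpha>"
  shows "set_integrable lborel {0<..} (\<lambda>u. exp (- (A * u powr \<alpha>)) * sin (B * u powr \<alpha>) / u)"
    and "(LINT u:{0<..}|lborel. exp (- (A * u powr \<alpha>)) * sin (B * u powr \<alpha>) / u) = arctan (B / A) / \<alpha>"
proof -
  define f where "f v = exp (- (A * v)) * sin (B * v) / v" for v :: real
  define g where "g u = u powr \<alpha>" for u :: real
  define g' where "g' u = \<alpha> * u powr (\<alpha> - 1)" for u :: real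
  have f: "set_integrable lborel {0<..} f" "(LINT v:{0<..}|lborel. f v) = arctan (B / A)"
    unfolding f_def using Laplace_sinc_integral[OF assms(1)] by auto
  have image: "g ` {0<..} = {0<..}"
  proof
    show "{0<..} \<subseteq> g ` {0<..}"
    proof
      fix v :: real assume "v \<in> {0<..}"
      then have "g (v powr (1 / \<alpha>)) = v" "v powr (1 / \<alpha>) \<in> {0<..}"
        using assms by (auto simp: g_def powr_powr)
      then show "v \<in> g ` {0<..}" by (metis imageI)
    qed
  qed (auto simp: g_def)
  have inj: "inj_on g {0<..}"
  proof (rule inj_on_inverseI)
    show "g u powr (1 / \<alpha>) = u" if "u \<in> {0<..}" for u
      using that assms by (simp add: g_def powr_powr)
  qed
  have der: "(g has_field_derivative g' u) (at u within {0<..})" if "u \<in> {0<..}" for u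
    unfolding g_def g'_def using that by (auto intro!: derivative_eq_intros)
  have "f absolutely_integrable_on {0<..}"
    using f(1) by (simp add: set_integrable_def integrable_completion)
  moreover have "integral {0<..} f = arctan (B / A)"
    using set_borel_integral_eq_integral(2)[OF f(1)] f(2) by simp
  moreover have "{0::real<..} \<in> sets lebesgue" by simp
  ultimately have h: "(\<lambda>u. \<bar>g' u\<bar> * f (g u)) absolutely_integrable_on {0<..}"
    "integral {0<..} (\<lambda>u. \<bar>g' u\<bar> * f (g u)) = arctan (B / A)"
    using has_absolute_integral_change_of_variables_1'[OF _ der inj, of f "arctan (B / A)"]
    unfolding image by blast+
  have eq: "\<bar>g' u\<bar> * f (g u) = \<alpha> * (exp (- (A * u powr \<alpha>)) * sin (B * u powr \<alpha>) / u)" if "u \<in> {0<..}" for u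
  proof -
    have "u powr (\<alpha> - 1) = u powr \<alpha> / u" using that by (simp add: powr_diff)
    then show ?thesis using that assms by (simp add: g'_def f_def g_def field_simps)
  qed
  let ?h = "\<lambda>u. exp (- (A * u powr \<alpha>)) * sin (B * u powr \<alpha>) / u"
  have "set_integrable lborel {0<..} (\<lambda>u. \<bar>g' u\<bar> * f (g u))"
  proof -
    have "(\<lambda>u. indicator {0<..} u *\<^sub>R (\<bar>g' u\<bar> * f (g u))) \<in> borel_measurable lborel"
      unfolding g'_def f_def g_def by measurable
    with h(1) show ?thesis by (simp add: set_integrable_def integrable_completion)
  qed
  then have h': "set_integrable lborel {0<..} (\<lambda>u. \<alpha> * ?h u)"
    by (rule set_integrable_cong[THEN iffD1, rotated -1]) (simp_all add: eq)
  then show "set_integrable lborel {0<..} ?h"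
    by (rule set_integrable_mult_right_iff[THEN iffD1, rotated]) (use assms in simp)
  have "(LINT u:{0<..}|lborel. \<alpha> * ?h u) = arctan (B / A)"
  proof -
    have "integral {0<..} (\<lambda>u. \<alpha> * ?h u) = integral {0<..} (\<lambda>u. \<bar>g' u\<bar> * f (g u))"
      by (rule Henstock_Kurzweil_Integration.integral_cong) (rule eq[symmetric])
    then show ?thesis
      by (simp only: set_borel_integral_eq_integral(2)[OF h'] h(2))
  qed
  moreover have "(LINT u:{0<..}|lborel. \<alpha> * ?h u) = \<alpha> * (LINT u:{0<..}|lborel. ?h u)"
    by (rule set_integral_mult_right)
  ultimately have "(LINT u:{0<..}|lborel. ?h u) * \<alpha> = arctan (B / A)"
    by (simp only: mult.commute)
  then show "(LINT u:{0<..}|lborel. ?h u) = arctan (B / A) / \<alpha>"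
    by (rule eq_divide_imp[rotated]) (use assms in simp)
qed

section \<open>The characteristic exponent of a stable process\<close>

text \<open>Homogeneity of y^(-\<alpha> - 1) dy under dilations; it is the source of the factor
  |u|^\<alpha> in the exponent.\<close>

lemma set_integral_power_scale:
  fixes h :: "real \<Rightarrow> real"
  assumes "0 < c"
  shows "(LINT y:{0<..}|lborel. h (c * y) * y powr (- \<alpha> - 1)) = c powr \<alpha> * (LINT y:{0<..}|lborel. h y * y powr (- \<alpha> - 1))"
proof -
  have "(LINT y|lborel. indicator {0<..} y *\<^sub>R (h y * y powr (- \<alpha> - 1)))
      = \<bar>c\<bar> *\<^sub>R (LINT y|lborel. indicator {0<..} (0 + c * y) *\<^sub>R (h (0 + c * y) * (0 + c * y) powr (- \<alpha> - 1)))"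
    using assms by (intro lborel_integral_real_affine) auto
  also have "\<dots> = c * (LINT y|lborel. c powr (- \<alpha> - 1) * (indicator {0<..} y *\<^sub>R (h (c * y) * y powr (- \<alpha> - 1))))"
    using assms by (simp add: indicator_def powr_mult zero_less_mult_iff mult_ac if_distrib cong: if_cong)
  also have "\<dots> = c * c powr (- \<alpha> - 1) * (LINT y|lborel. indicator {0<..} y *\<^sub>R (h (c * y) * y powr (- \<alpha> - 1)))"
    by (simp only: integral_mult_right_zero mult.assoc)
  also have "c * c powr (- \<alpha> - 1) = c powr (- \<alpha>)"
    using assms powr_add[of c 1 "- \<alpha> - 1"] by simp
  finally have "c powr \<alpha> * (LINT y:{0<..}|lborel. h y * y powr (- \<alpha> - 1))
      = (c powr \<alpha> * c powr (- \<alpha>)) * (LINT y:{0<..}|lborel. h (c * y) * y powr (- \<alpha> - 1))"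
    by (simp only: set_lebesgue_integral_def mult.assoc)
  then show ?thesis
    using assms by (simp flip: powr_add)
qed

lemma set_integrable_power_scale:
  fixes h :: "real \<Rightarrow> real"
  assumes "0 < c" "set_integrable lborel {0<..} (\<lambda>y. h y * y powr (- \<alpha> - 1))"
  shows "set_integrable lborel {0<..} (\<lambda>y. h (c * y) * y powr (- \<alpha> - 1))"
proof -
  have "integrable lborel (\<lambda>y. indicator {0<..} (0 + c * y) *\<^sub>R (h (0 + c * y) * (0 + c * y) powr (- \<alpha> - 1)))"
    using assms by (subst lborel_integrable_real_affine_iff) (auto simp: set_integrable_def)
  also have "(\<lambda>y. indicator {0<..} (0 + c * y) *\<^sub>R (h (0 + c * y) * (0 + c * y) powr (- \<alpha> - 1)))
      = (\<lambda>y. c powr (- \<alpha> - 1) * (indicator {0<..} y *\<^sub>R (h (c * y) * y powr (- \<alpha> - 1))))"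
    using assms(1) by (auto simp: indicator_def powr_mult zero_less_mult_iff)
  finally show ?thesis
    using assms(1) by (simp add: set_integrable_def)
qed

lemma stable_levy_density_measurable [measurable]:
  "stable_levy_density \<alpha> cp cm \<in> borel_measurable borel"
  unfolding stable_levy_density_def by measurable

lemma stable_levy_density_nonneg:
  "0 \<le> cp \<Longrightarrow> 0 \<le> cm \<Longrightarrow> 0 \<le> stable_levy_density \<alpha> cp cm y"
  by (simp add: stable_levy_density_def)

lemma stable_levy_density_integral:
  fixes g :: "real \<Rightarrow> 'b::{banach, second_countable_topology}"
  assumes R: "set_integrable lborel {0<..} (\<lambda>y. y powr (- \<alpha> - 1) *\<^sub>R g y)"
    and L: "set_integrable lborel {0<..} (\<lambda>y. y powr (- \<alpha> - 1) *\<^sub>R g (- y))"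
  shows "integrable lborel (\<lambda>y. stable_levy_density \<alpha> cp cm y *\<^sub>R g y)"
    and "(LINT y|lborel. stable_levy_density \<alpha> cp cm y *\<^sub>R g y)
      = cp *\<^sub>R (LINT y:{0<..}|lborel. y powr (- \<alpha> - 1) *\<^sub>R g y)
        + cm *\<^sub>R (LINT y:{0<..}|lborel. y powr (- \<alpha> - 1) *\<^sub>R g (- y))"
proof -
  define r where "r y = indicator {0<..} y *\<^sub>R y powr (- \<alpha> - 1) *\<^sub>R g y" for y :: real
  define l where "l y = indicator {0<..} y *\<^sub>R y powr (- \<alpha> - 1) *\<^sub>R g (- y)" for y :: real
  have eq: "stable_levy_density \<alpha> cp cm y *\<^sub>R g y = cp *\<^sub>R r y + cm *\<^sub>R l (0 + (- 1) * y)" for y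
    by (auto simp: stable_levy_density_def r_def l_def indicator_def)
  have r: "integrable lborel r" and l: "integrable lborel l"
    using R L unfolding r_def l_def set_integrable_def by simp_all
  have l': "integrable lborel (\<lambda>y. l (0 + (- 1) * y))"
    using l by (subst lborel_integrable_real_affine_iff) auto
  have l'': "(LINT y|lborel. l (0 + (- 1) * y)) = (LINT y|lborel. l y)"
    using lborel_integral_real_affine[of "- 1" l 0] by simp
  show "integrable lborel (\<lambda>y. stable_levy_density \<alpha> cp cm y *\<^sub>R g y)"
    unfolding eq using r l' by (intro Bochner_Integration.integrable_add integrable_scaleR_right)
  have "(LINT y|lborel. stable_levy_density \<alpha> cp cm y *\<^sub>R g y) = cp *\<^sub>R (LINT y|lborel. r y) + cm *\<^sub>R (LINT y|lborel. l y)"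
    unfolding eq l''[symmetric] using r l' by (subst Bochner_Integration.integral_add) auto
  then show "(LINT y|lborel. stable_levy_density \<alpha> cp cm y *\<^sub>R g y)
      = cp *\<^sub>R (LINT y:{0<..}|lborel. y powr (- \<alpha> - 1) *\<^sub>R g y)
        + cm *\<^sub>R (LINT y:{0<..}|lborel. y powr (- \<alpha> - 1) *\<^sub>R g (- y))"
    by (simp add: r_def l_def set_lebesgue_integral_def)
qed

definition levy_kernel :: "real \<Rightarrow> real \<Rightarrow> complex" where
  "levy_kernel u y = iexp (u * y) - 1 - \<i> * of_real (u * y * indicator {y. \<bar>y\<bar> < 1} y)"

lemma levy_kernel_measurable [measurable]: "levy_kernel u \<in> borel_measurable borel"
  unfolding levy_kernel_def by measurable

text \<open>For |y| < 1 the compensator leaves a second-order Taylor remainder, and otherwise the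
  trivial bound 2 holds. The majorant \<open>min 1 (y\<^sup>2)\<close> is integrable for every Levy
  measure, and the prefactor records the growth in u.\<close>

lemma norm_levy_kernel_le: "norm (levy_kernel u y) \<le> (2 + u\<^sup>2) * min 1 (y\<^sup>2)"
proof (cases "\<bar>y\<bar> < 1")
  case True
  then have "norm (levy_kernel u y) \<le> (u * y)\<^sup>2 / 2"
    using iexp_approx1[of "u * y" 1] by (simp add: levy_kernel_def numeral_2_eq_2 algebra_simps)
  also have "\<dots> \<le> (2 + u\<^sup>2) * y\<^sup>2"
    by (simp add: algebra_simps power_mult_distrib)
  also have "y\<^sup>2 = min 1 (y\<^sup>2)"
    using True by (intro min.absorb2[symmetric]) (simp add: abs_square_le_1 less_imp_le)
  finally show ?thesis .
next
  case False
  then have "norm (levy_kernel u y) \<le> 2"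
    using norm_triangle_ineq4[of "iexp (u * y)" 1] by (simp add: levy_kernel_def)
  moreover have "1 \<le> y\<^sup>2" using False by (simp add: abs_square_less_1 not_less flip: not_less)
  ultimately show ?thesis by (simp add: min_def) (use zero_le_power2[of u] in linarith)
qed

lemma min_1_power2_powr_integrable:
  fixes g :: "real \<Rightarrow> 'b::{banach, second_countable_topology}"
  assumes "0 < \<alpha>" "\<alpha> < 2" and [measurable]: "g \<in> borel_measurable borel"
    and "\<And>y. norm (g y) \<le> C * min 1 (y\<^sup>2)"
  shows "set_integrable lborel {0<..} (\<lambda>y. y powr (- \<alpha> - 1) *\<^sub>R g y)"
proof (rule set_integrable_power_bounds[where p = "1 - \<alpha>" and q = "- \<alpha> - 1" and C = C])
  have C: "0 \<le> C" using norm_ge_zero[of "g 1"] assms(4)[of 1] by (simp del: norm_ge_zero)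
  fix y :: real assume y: "0 < y"
  have "norm (y powr (- \<alpha> - 1) *\<^sub>R g y) \<le> y powr (- \<alpha> - 1) * (C * min 1 (y\<^sup>2))"
    using assms(4)[of y] by (simp add: mult_left_mono)
  also have "\<dots> \<le> y powr (- \<alpha> - 1) * (C * y\<^sup>2)"
    using C by (intro mult_left_mono) auto
  also have "\<dots> = C * y powr (1 - \<alpha>)"
    using y powr_add[of y 2 "- \<alpha> - 1"] by simp
  finally show "norm (y powr (- \<alpha> - 1) *\<^sub>R g y) \<le> C * y powr (1 - \<alpha>)" .
next
  have C: "0 \<le> C" using norm_ge_zero[of "g 1"] assms(4)[of 1] by (simp del: norm_ge_zero)
  fix y :: real
  have "norm (y powr (- \<alpha> - 1) *\<^sub>R g y) \<le> y powr (- \<alpha> - 1) * (C * min 1 (y\<^sup>2))"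
    using assms(4)[of y] by (simp add: mult_left_mono)
  also have "\<dots> \<le> y powr (- \<alpha> - 1) * (C * 1)"
    using C by (intro mult_left_mono) auto
  finally show "norm (y powr (- \<alpha> - 1) *\<^sub>R g y) \<le> C * y powr (- \<alpha> - 1)" by (simp add: mult.commute)
qed (use assms in auto)

section \<open>Growth, closed form and second differences of the exponent\<close>

locale stable_parameters =
  fixes \<alpha> cp cm :: real
  assumes \<alpha>: "0 < \<alpha>" "\<alpha> < 2" and c: "0 \<le> cp" "0 \<le> cm" "0 < cp + cm"
begin

abbreviation "\<nu> \<equiv> stable_levy_density \<alpha> cp cm"
abbreviation "\<psi> \<equiv> stable_exponent \<alpha> cp cm"

lemma levy_integrable:
  fixes g :: "real \<Rightarrow> 'b::{banach, second_countable_topology}"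
  assumes "g \<in> borel_measurable borel" "\<And>y. norm (g y) \<le> C * min 1 (y\<^sup>2)"
  shows "integrable lborel (\<lambda>y. \<nu> y *\<^sub>R g y)"
    and "(LINT y|lborel. \<nu> y *\<^sub>R g y)
      = cp *\<^sub>R (LINT y:{0<..}|lborel. y powr (- \<alpha> - 1) *\<^sub>R g y)
        + cm *\<^sub>R (LINT y:{0<..}|lborel. y powr (- \<alpha> - 1) *\<^sub>R g (- y))"
proof -
  have "set_integrable lborel {0<..} (\<lambda>y. y powr (- \<alpha> - 1) *\<^sub>R g y)"
    using assms by (intro min_1_power2_powr_integrable[OF \<alpha>])
  moreover have "set_integrable lborel {0<..} (\<lambda>y. y powr (- \<alpha> - 1) *\<^sub>R g (- y))"
    using assms(1) by (intro min_1_power2_powr_integrable[OF \<alpha>, where C = C]) (auto intro: order_trans[OF assms(2)])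
  ultimately show "integrable lborel (\<lambda>y. \<nu> y *\<^sub>R g y)"
    and "(LINT y|lborel. \<nu> y *\<^sub>R g y)
      = cp *\<^sub>R (LINT y:{0<..}|lborel. y powr (- \<alpha> - 1) *\<^sub>R g y)
        + cm *\<^sub>R (LINT y:{0<..}|lborel. y powr (- \<alpha> - 1) *\<^sub>R g (- y))"
    by (rule stable_levy_density_integral)+
qed

lemma levy_kernel_integrable: "integrable lborel (\<lambda>y. \<nu> y *\<^sub>R levy_kernel u y)"
  by (rule levy_integrable(1)[OF levy_kernel_measurable norm_levy_kernel_le])

lemma exponent_eq:
  "\<psi> u = \<i> * of_real (stable_drift \<alpha> cp cm * u) + (CLINT y|lborel. \<nu> y *\<^sub>R levy_kernel u y)"
  by (simp add: stable_exponent_def levy_kernel_def scaleR_conv_of_real mult.commute)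

text \<open>Quadratic growth makes the exponent integrable against a Gaussian, which is how
  \<open>exponent_tail_bound\<close> uses it.\<close>

lemma norm_exponent_le: "\<exists>D. \<forall>u. norm (\<psi> u) \<le> D * (1 + u\<^sup>2)"
proof -
  define a where "a = \<bar>stable_drift \<alpha> cp cm\<bar>"
  define K where "K = (LINT y|lborel. \<nu> y *\<^sub>R min 1 (y\<^sup>2))"
  have int: "integrable lborel (\<lambda>y. \<nu> y *\<^sub>R min 1 (y\<^sup>2))"
    by (rule levy_integrable(1)[where C = 1]) auto
  have "norm (\<psi> u) \<le> (a + 2 * K) * (1 + u\<^sup>2)" for u
  proof -
    have "norm (CLINT y|lborel. \<nu> y *\<^sub>R levy_kernel u y) \<le> (LINT y|lborel. norm (\<nu> y *\<^sub>R levy_kernel u y))"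
      by (rule integral_norm_bound)
    also have "\<dots> \<le> (LINT y|lborel. (2 + u\<^sup>2) * (\<nu> y *\<^sub>R min 1 (y\<^sup>2)))"
    proof (rule integral_mono)
      show "norm (\<nu> y *\<^sub>R levy_kernel u y) \<le> (2 + u\<^sup>2) * (\<nu> y *\<^sub>R min 1 (y\<^sup>2))" for y
        using mult_left_mono[OF norm_levy_kernel_le[of u y] stable_levy_density_nonneg[OF c(1,2), of \<alpha> y]]
          stable_levy_density_nonneg[OF c(1,2), of \<alpha> y] by (simp add: mult_ac)
      show "integrable lborel (\<lambda>y. norm (\<nu> y *\<^sub>R levy_kernel u y))"
        by (rule integrable_norm[OF levy_kernel_integrable])
    qed (use int in auto)
    also have "\<dots> = (2 + u\<^sup>2) * K" by (simp add: K_def)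
    finally have 1: "norm (CLINT y|lborel. \<nu> y *\<^sub>R levy_kernel u y) \<le> (2 + u\<^sup>2) * K" .
    have K: "0 \<le> K" unfolding K_def
      using stable_levy_density_nonneg[OF c(1,2)] by (intro integral_nonneg_AE) auto
    have "\<bar>u\<bar> \<le> 1 + u\<^sup>2"
      using zero_le_power2[of "\<bar>u\<bar> - 1"] by (simp add: power2_diff)
    then have "a * \<bar>u\<bar> \<le> a * (1 + u\<^sup>2)" by (intro mult_left_mono) (auto simp: a_def)
    moreover have "(2 + u\<^sup>2) * K \<le> 2 * K * (1 + u\<^sup>2)" using K by (simp add: algebra_simps)
    moreover have "norm (\<psi> u) \<le> a * \<bar>u\<bar> + norm (CLINT y|lborel. \<nu> y *\<^sub>R levy_kernel u y)"
      unfolding exponent_eq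
      using norm_triangle_ineq[of "\<i> * of_real (stable_drift \<alpha> cp cm * u)" "CLINT y|lborel. \<nu> y *\<^sub>R levy_kernel u y"]
      by (simp add: norm_mult a_def abs_mult)
    ultimately show ?thesis using 1 by (simp add: algebra_simps)
  qed
  then show ?thesis by blast
qed

lemma one_minus_cos_le: "norm (1 - cos (u * y)) \<le> (2 + u\<^sup>2) * min 1 (y\<^sup>2)" for u y :: real
proof -
  have "1 - cos (u * y) = - Re (levy_kernel u y)"
    by (simp add: levy_kernel_def Re_exp)
  then have "norm (1 - cos (u * y)) \<le> norm (levy_kernel u y)"
    using abs_Re_le_cmod[of "levy_kernel u y"] by simp
  with norm_levy_kernel_le[of u y] show ?thesis by linarith
qed

lemma one_minus_cos_integrable: "integrable lborel (\<lambda>y. \<nu> y *\<^sub>R (1 - cos (u * y)))"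
  by (rule levy_integrable(1)[OF _ one_minus_cos_le]) measurable

lemma Re_exponent: "Re (\<psi> u) = - (LINT y|lborel. \<nu> y *\<^sub>R (1 - cos (u * y)))"
proof -
  have "Re (\<psi> u) = (LINT y|lborel. Re (\<nu> y *\<^sub>R levy_kernel u y))"
    unfolding exponent_eq using integral_Re[OF levy_kernel_integrable[of u]] by simp
  also have "\<dots> = (LINT y|lborel. - (\<nu> y *\<^sub>R (1 - cos (u * y))))"
    by (intro Bochner_Integration.integral_cong) (auto simp: levy_kernel_def Re_exp algebra_simps)
  finally show ?thesis by simp
qed

lemma Re_exponent_eq:
  "Re (\<psi> u) = - ((cp + cm) * (\<bar>u\<bar> powr \<alpha> * (pi / (2 * sin (pi * \<alpha> / 2) * Gamma (\<alpha> + 1)))))"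
proof -
  have "(LINT y|lborel. \<nu> y *\<^sub>R (1 - cos (u * y)))
      = (cp + cm) * (LINT y:{0<..}|lborel. (1 - cos (u * y)) * y powr (- \<alpha> - 1))"
    by (subst levy_integrable(2)[OF _ one_minus_cos_le]) (auto simp: algebra_simps)
  also have "(LINT y:{0<..}|lborel. (1 - cos (u * y)) * y powr (- \<alpha> - 1))
      = \<bar>u\<bar> powr \<alpha> * (LINT y:{0<..}|lborel. (1 - cos y) * y powr (- \<alpha> - 1))"
  proof (cases "u = 0")
    case False
    have "(1 - cos (u * y)) = (\<lambda>z. 1 - cos z) (\<bar>u\<bar> * y)" for y
      by (cases "0 \<le> u") auto
    then show ?thesis
      using False set_integral_power_scale[of "\<bar>u\<bar>" "\<lambda>z. 1 - cos z" \<alpha>] by simp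
  qed simp
  finally show ?thesis
    unfolding Re_exponent one_minus_cos_power_integral(2)[OF \<alpha>] by (simp only:)
qed

lemma one_minus_cos_constant_pos: "0 < pi / (2 * sin (pi * \<alpha> / 2) * Gamma (\<alpha> + 1))"
proof -
  have "0 < sin (pi * \<alpha> / 2)" using \<alpha> by (intro sin_gt_zero) (auto simp: field_simps)
  moreover have "0 < Gamma (\<alpha> + 1)" using \<alpha> by (intro Gamma_real_pos) auto
  ultimately show ?thesis by simp
qed

lemma Re_exponent_neg: "u \<noteq> 0 \<Longrightarrow> Re (\<psi> u) < 0"
  unfolding Re_exponent_eq neg_less_0_iff_less
  by (intro mult_pos_pos one_minus_cos_constant_pos c(3)) simp

lemma Re_exponent_le: "Re (\<psi> u) \<le> 0"
  using Re_exponent_neg[of u] by (cases "u = 0") (auto simp: Re_exponent)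

text \<open>The cutoff at 1 is traded for the natural compensation: none below index 1, the full
  linear term above it. The first correction is -u times the integral of y^(-\<alpha>) over (0, 1),
  the second u times its integral over [1, \<infinity>); both equal -u / (1 - \<alpha>).\<close>

lemma compensated_sine_integral:
  assumes "\<alpha> \<noteq> 1" "0 < u"
  shows "(LINT y:{0<..}|lborel. y powr (- \<alpha> - 1) *\<^sub>R (sin (u * y) - u * y * indicator {y. \<bar>y\<bar> < 1} y))
    = u powr \<alpha> * (pi / (2 * cos (pi * \<alpha> / 2) * Gamma (\<alpha> + 1))) - u / (1 - \<alpha>)"
proof (cases "\<alpha> < 1")
  case True
  note S = sin_power_integral_less_1[OF \<alpha>(1) True]
  note S' = set_integrable_power_scale[OF assms(2) S(1)]
  have I: "((\<lambda>y. y powr (- \<alpha>)) has_integral 1 / (1 - \<alpha>)) {0<..<1}"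
    using has_integral_powr_from_0[of "- \<alpha>" 1] True has_integral_Icc_iff_Ioo by fastforce
  have J: "set_integrable lborel {0<..<1} (\<lambda>y. y powr (- \<alpha>))" "(LINT y:{0<..<1}|lborel. y powr (- \<alpha>)) = 1 / (1 - \<alpha>)"
    using set_integrable_lborel_nonneg[OF _ _ _ I] by auto
  have "(LINT y:{0<..}|lborel. y powr (- \<alpha> - 1) *\<^sub>R (sin (u * y) - u * y * indicator {y. \<bar>y\<bar> < 1} y))
      = (LINT y|lborel. indicator {0<..} y *\<^sub>R (sin (u * y) * y powr (- \<alpha> - 1)) - u * (indicator {0<..<1} y *\<^sub>R y powr (- \<alpha>)))"
    unfolding set_lebesgue_integral_def
  proof (intro Bochner_Integration.integral_cong refl)
    fix y :: real
    have "0 < y \<Longrightarrow> y powr (- \<alpha>) = y * y powr (- \<alpha> - 1)"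
      using powr_add[of y 1 "- \<alpha> - 1"] by simp
    then show "indicator {0<..} y *\<^sub>R (y powr (- \<alpha> - 1) *\<^sub>R (sin (u * y) - u * y * indicator {y. \<bar>y\<bar> < 1} y))
        = indicator {0<..} y *\<^sub>R (sin (u * y) * y powr (- \<alpha> - 1)) - u * (indicator {0<..<1} y *\<^sub>R y powr (- \<alpha>))"
      by (auto simp: indicator_def algebra_simps)
  qed
  also have "\<dots> = (LINT y:{0<..}|lborel. sin (u * y) * y powr (- \<alpha> - 1)) - u * (LINT y:{0<..<1}|lborel. y powr (- \<alpha>))"
    using S' J(1) unfolding set_integrable_def set_lebesgue_integral_def
    by (subst Bochner_Integration.integral_diff) simp_all
  finally show ?thesis
    unfolding J(2) set_integral_power_scale[OF assms(2)] S(2) by simp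
next
  case False
  with assms have "1 < \<alpha>" by simp
  note S = sin_power_integral_greater_1[OF this \<alpha>(2)]
  note S' = set_integrable_power_scale[OF assms(2) S(1)]
  have I: "((\<lambda>y. y powr (- \<alpha>)) has_integral - 1 / (1 - \<alpha>)) {1..}"
    using has_integral_powr_to_inf[of "- \<alpha>" 1] \<open>1 < \<alpha>\<close> by simp
  have J: "set_integrable lborel {1..} (\<lambda>y. y powr (- \<alpha>))" "(LINT y:{1..}|lborel. y powr (- \<alpha>)) = - 1 / (1 - \<alpha>)"
    using set_integrable_lborel_nonneg[OF _ _ _ I] by auto
  have "(LINT y:{0<..}|lborel. y powr (- \<alpha> - 1) *\<^sub>R (sin (u * y) - u * y * indicator {y. \<bar>y\<bar> < 1} y))
      = (LINT y|lborel. indicator {0<..} y *\<^sub>R ((sin (u * y) - u * y) * y powr (- \<alpha> - 1)) + u * (indicator {1..} y *\<^sub>R y powr (- \<alpha>)))"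
    unfolding set_lebesgue_integral_def
  proof (intro Bochner_Integration.integral_cong refl)
    fix y :: real
    have "0 < y \<Longrightarrow> y powr (- \<alpha>) = y * y powr (- \<alpha> - 1)"
      using powr_add[of y 1 "- \<alpha> - 1"] by simp
    then show "indicator {0<..} y *\<^sub>R (y powr (- \<alpha> - 1) *\<^sub>R (sin (u * y) - u * y * indicator {y. \<bar>y\<bar> < 1} y))
        = indicator {0<..} y *\<^sub>R ((sin (u * y) - u * y) * y powr (- \<alpha> - 1)) + u * (indicator {1..} y *\<^sub>R y powr (- \<alpha>))"
      by (auto simp: indicator_def algebra_simps)
  qed
  also have "\<dots> = (LINT y:{0<..}|lborel. (sin (u * y) - u * y) * y powr (- \<alpha> - 1)) + u * (LINT y:{1..}|lborel. y powr (- \<alpha>))"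
    using S' J(1) unfolding set_integrable_def set_lebesgue_integral_def
    by (subst Bochner_Integration.integral_add) simp_all
  finally show ?thesis
    unfolding J(2) set_integral_power_scale[OF assms(2), of "\<lambda>z. sin z - z"] S(2) by simp
qed

text \<open>The drift is exactly the constant that cancels the cutoff term -u / (1 - \<alpha>), so
  only the part homogeneous of degree \<alpha> survives. The factor cp - cm arises because the
  compensated sine is odd in y.\<close>

lemma Im_exponent_eq:
  assumes "\<alpha> \<noteq> 1" "0 < u"
  shows "Im (\<psi> u) = (cp - cm) * (u powr \<alpha> * (pi / (2 * cos (pi * \<alpha> / 2) * Gamma (\<alpha> + 1))))"
proof -
  define s where "s y = sin (u * y) - u * y * indicator {y. \<bar>y\<bar> < 1} y" for y
  have Im: "Im (levy_kernel u y) = s y" for y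
    by (simp add: levy_kernel_def s_def Im_exp)
  have s_le: "norm (s y) \<le> (2 + u\<^sup>2) * min 1 (y\<^sup>2)" for y
    using abs_Im_le_cmod[of "levy_kernel u y"] norm_levy_kernel_le[of u y] unfolding Im by simp
  have s_minus: "s (- y) = - s y" for y
    by (simp add: s_def indicator_def)
  have [measurable]: "s \<in> borel_measurable borel"
    unfolding s_def by measurable
  have "Im (\<psi> u) = stable_drift \<alpha> cp cm * u + (LINT y|lborel. \<nu> y *\<^sub>R s y)"
    unfolding exponent_eq using integral_Im[OF levy_kernel_integrable[of u]] by (simp add: Im)
  also have "(LINT y|lborel. \<nu> y *\<^sub>R s y) = (cp - cm) * (LINT y:{0<..}|lborel. y powr (- \<alpha> - 1) *\<^sub>R s y)"
  proof -
    have "(LINT y:{0<..}|lborel. y powr (- \<alpha> - 1) *\<^sub>R s (- y)) = - (LINT y:{0<..}|lborel. y powr (- \<alpha> - 1) *\<^sub>R s y)"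
      unfolding s_minus set_lebesgue_integral_def by simp
    then show ?thesis
      by (subst levy_integrable(2)[OF _ s_le]) (auto simp: algebra_simps)
  qed
  also have "\<dots> = (cp - cm) * (u powr \<alpha> * (pi / (2 * cos (pi * \<alpha> / 2) * Gamma (\<alpha> + 1))) - u / (1 - \<alpha>))"
    unfolding s_def compensated_sine_integral[OF assms] ..
  also have "stable_drift \<alpha> cp cm * u = (cp - cm) * (u / (1 - \<alpha>))"
    using assms(1) by (simp add: stable_drift_def)
  also have "(cp - cm) * (u / (1 - \<alpha>)) + (cp - cm) * (u powr \<alpha> * (pi / (2 * cos (pi * \<alpha> / 2) * Gamma (\<alpha> + 1))) - u / (1 - \<alpha>))
      = (cp - cm) * (u powr \<alpha> * (pi / (2 * cos (pi * \<alpha> / 2) * Gamma (\<alpha> + 1))))"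
    by (simp only: right_diff_distrib add_diff_cancel_left' diff_add_cancel add.commute)
  finally show ?thesis .
qed

text \<open>Taking a second difference removes drift, constant and compensator, and multiplies the
  remaining oscillation by 1 - cos (\<eta> y), which tames the singularity at 0. The right side is
  thus the Fourier transform of a finite measure.\<close>

lemma exponent_second_difference:
  "\<psi> u - (\<psi> (u + \<eta>) + \<psi> (u - \<eta>)) / 2 = (CLINT y|lborel. (\<nu> y * (1 - cos (\<eta> * y))) *\<^sub>R iexp (u * y))"
proof -
  have "(CLINT y|lborel. \<nu> y *\<^sub>R levy_kernel u y) - ((CLINT y|lborel. \<nu> y *\<^sub>R levy_kernel (u + \<eta>) y)
        + (CLINT y|lborel. \<nu> y *\<^sub>R levy_kernel (u - \<eta>) y)) / 2
      = (CLINT y|lborel. \<nu> y *\<^sub>R levy_kernel u y - (\<nu> y *\<^sub>R levy_kernel (u + \<eta>) y + \<nu> y *\<^sub>R levy_kernel (u - \<eta>) y) / 2)"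
    using levy_kernel_integrable by simp
  also have "\<dots> = (CLINT y|lborel. (\<nu> y * (1 - cos (\<eta> * y))) *\<^sub>R iexp (u * y))"
  proof (intro Bochner_Integration.integral_cong refl)
    fix y
    have "iexp ((u + \<eta>) * y) + iexp ((u - \<eta>) * y) = iexp (u * y) * (2 * cos (of_real (\<eta> * y)))"
      by (simp add: cos_exp_eq algebra_simps flip: exp_add)
    then have "iexp ((u + \<eta>) * y) + iexp ((u - \<eta>) * y) = iexp (u * y) * (2 * of_real (cos (\<eta> * y)))"
      by (simp only: cos_of_real)
    then have "levy_kernel u y - (levy_kernel (u + \<eta>) y + levy_kernel (u - \<eta>) y) / 2 = of_real (1 - cos (\<eta> * y)) * iexp (u * y)"
      unfolding levy_kernel_def by (simp add: field_simps)
    moreover have "\<nu> y *\<^sub>R levy_kernel u y - (\<nu> y *\<^sub>R levy_kernel (u + \<eta>) y + \<nu> y *\<^sub>R levy_kernel (u - \<eta>) y) / 2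
        = of_real (\<nu> y) * (levy_kernel u y - (levy_kernel (u + \<eta>) y + levy_kernel (u - \<eta>) y) / 2)"
      by (simp add: scaleR_conv_of_real algebra_simps add_divide_distrib)
    ultimately show "\<nu> y *\<^sub>R levy_kernel u y - (\<nu> y *\<^sub>R levy_kernel (u + \<eta>) y + \<nu> y *\<^sub>R levy_kernel (u - \<eta>) y) / 2
        = (\<nu> y * (1 - cos (\<eta> * y))) *\<^sub>R iexp (u * y)"
      by (simp only: scaleR_conv_of_real of_real_mult mult.assoc)
  qed
  finally show ?thesis
    unfolding exponent_eq by (simp add: field_simps)
qed

end

section \<open>The negativity parameter and the value of the constant k\<close>

context stable_parameters
begin

text \<open>For u > 0 the characteristic function is exp (-A u^\<alpha> + i B u^\<alpha>), so the
  Gil-Pelaez integral is the arctangent integral with B / A = \<beta> tan (\<pi>\<alpha>/2). It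
  yields only the difference of the two half-line masses; decay of the modulus excludes an atom at
  0, so their sum is 1.\<close>

lemma stable_negativity:
  assumes "\<alpha> \<noteq> 1" "real_distribution M" "\<And>u. char M u = exp (\<psi> u)"
  shows "measure M {..<0} = 1 / 2 - arctan (stable_skewness cp cm * tan (pi * \<alpha> / 2)) / (pi * \<alpha>)"
proof -
  interpret real_distribution M by fact
  define A where "A = (cp + cm) * (pi / (2 * sin (pi * \<alpha> / 2) * Gamma (\<alpha> + 1)))"
  define B where "B = (cp - cm) * (pi / (2 * cos (pi * \<alpha> / 2) * Gamma (\<alpha> + 1)))"
  have A: "0 < A"
    unfolding A_def by (intro mult_pos_pos c one_minus_cos_constant_pos)
  have "0 < sin (pi * \<alpha> / 2)" using \<alpha> by (intro sin_gt_zero) (auto simp: field_simps)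
  moreover have "0 < Gamma (\<alpha> + 1)" using \<alpha> by (intro Gamma_real_pos) auto
  ultimately have BA: "B / A = stable_skewness cp cm * tan (pi * \<alpha> / 2)"
    using c(3) by (simp add: A_def B_def stable_skewness_def tan_def)
  have norm_char: "norm (char M u) = exp (- (A * \<bar>u\<bar> powr \<alpha>))" for u
    by (simp add: assms(3) Re_exponent_eq A_def mult_ac)
  have "((\<lambda>u. exp (- (A * \<bar>u\<bar> powr \<alpha>))) \<longlongrightarrow> 0) at_top" "((\<lambda>u. exp (- (A * \<bar>u\<bar> powr \<alpha>))) \<longlongrightarrow> 0) at_bot"
    using A \<alpha>(1) by real_asymp+
  then have "(char M \<longlongrightarrow> 0) at_top" "(char M \<longlongrightarrow> 0) at_bot"
    by (auto simp flip: norm_char intro: tendsto_norm_zero_cancel)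
  then have atom: "measure M {0} = 0"
    by (rule atom_zero_of_char_vanishing)
  have Im_char: "Im (char M u) / u = exp (- (A * u powr \<alpha>)) * sin (B * u powr \<alpha>) / u" if "u \<in> {0<..}" for u
    using that by (simp add: assms(3) Im_exp Re_exponent_eq Im_exponent_eq[OF assms(1)] A_def B_def mult_ac)
  note I = stable_sinc_integral[OF A \<alpha>(1), of B]
  have "set_integrable lborel {0<..} (\<lambda>u. Im (char M u) / u)"
    using I(1) by (rule set_integrable_cong[THEN iffD1, rotated -1]) (simp_all add: Im_char)
  from Gil_Pelaez_zero[OF this]
  have "pi / 2 * (measure M {0<..} - measure M {..<0}) = (LINT u:{0<..}|lborel. Im (char M u) / u)" ..
  also have "\<dots> = (LINT u:{0<..}|lborel. exp (- (A * u powr \<alpha>)) * sin (B * u powr \<alpha>) / u)"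
    by (rule set_lebesgue_integral_cong) (auto simp: Im_char)
  also have "\<dots> = arctan (B / A) / \<alpha>"
    by (rule I(2))
  finally have 1: "pi / 2 * (measure M {0<..} - measure M {..<0}) = arctan (B / A) / \<alpha>" .
  have "1 = measure M ({..<0} \<union> {0} \<union> {0<..})"
  proof -
    have "{..<0} \<union> {0} \<union> {0<..} = (UNIV :: real set)" by auto
    then show ?thesis using prob_space by simp
  qed
  also have "\<dots> = measure M {..<0} + measure M {0} + measure M {0<..}"
    by (subst finite_measure_Union, simp, simp, force, subst finite_measure_Union) auto
  finally have 2: "measure M {0<..} = 1 - measure M {..<0}"
    using atom by simp
  have "1 - 2 * measure M {..<0} = arctan (B / A) / \<alpha> * (2 / pi)"
    unfolding 1[symmetric] 2 by simp
  then show ?thesis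
    unfolding BA by (simp add: field_simps)
qed

text \<open>With \<theta> = \<pi>\<alpha>/2 and w = \<beta> tan \<theta> the angle
  \<pi>\<alpha>\<rho> is \<theta> - arctan w. The square root in k is the secant of arctan w, so
  their product is sin \<theta> - w cos \<theta> = (1 - \<beta>) sin \<theta>. Reflection, with sin
  (2\<theta>) = 2 sin \<theta> cos \<theta>, cancels the trigonometric factors, and (cp + cm) (1 -
  \<beta>) = 2 cm.\<close>

lemma passage_constant_eq:
  assumes "\<alpha> \<noteq> 1" "\<rho> = 1 / 2 - arctan (stable_skewness cp cm * tan (pi * \<alpha> / 2)) / (pi * \<alpha>)"
  shows "passage_constant \<alpha> cp cm \<rho> = cm / \<alpha>"
proof -
  define \<theta> where "\<theta> = pi * \<alpha> / 2"
  define w where "w = stable_skewness cp cm * tan \<theta>"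
  have sin_pos: "0 < sin \<theta>"
    unfolding \<theta>_def using \<alpha> by (intro sin_gt_zero) (auto simp: field_simps)
  have cos_nz: "cos \<theta> \<noteq> 0"
  proof (cases "\<alpha> < 1")
    case True
    then have "0 < cos \<theta>" unfolding \<theta>_def using \<alpha> by (intro cos_gt_zero) (auto simp: field_simps)
    then show ?thesis by simp
  next
    case False
    then have "cos (pi - \<theta>) > 0" unfolding \<theta>_def using \<alpha> assms(1) by (intro cos_gt_zero) (auto simp: field_simps)
    then show ?thesis by simp
  qed
  have "pi * \<alpha> * \<rho> = \<theta> - arctan w"
    using \<alpha> by (simp add: assms(2) w_def \<theta>_def algebra_simps)
  then have "sqrt (1 + w\<^sup>2) * sin (pi * \<alpha> * \<rho>) = sqrt (1 + w\<^sup>2) * ((sin \<theta> - cos \<theta> * w) / sqrt (1 + w\<^sup>2))"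
    by (simp add: sin_diff cos_arctan sin_arctan diff_divide_distrib)
  also have "\<dots> = sin \<theta> - cos \<theta> * w"
    by (simp add: add_nonneg_eq_0_iff)
  also have "cos \<theta> * w = sin \<theta> * stable_skewness cp cm"
    using cos_nz by (simp add: w_def tan_def)
  finally have S: "sqrt (1 + w\<^sup>2) * sin (pi * \<alpha> * \<rho>) = sin \<theta> * (1 - stable_skewness cp cm)"
    by (simp add: algebra_simps)
  \<comment> \<open>The only integer strictly between 0 and 2 is 1, so \<open>Gamma\<close> has no
    pole at -\<alpha> and its functional equation applies there.\<close>
  have "- \<alpha> \<notin> \<int>\<^sub>\<le>\<^sub>0"
  proof
    assume "- \<alpha> \<in> \<int>\<^sub>\<le>\<^sub>0"
    then obtain n where "\<alpha> = real n" by (elim nonpos_Ints_cases') auto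
    with \<alpha> assms(1) show False by auto
  qed
  then have "Gamma (1 - \<alpha>) = - \<alpha> * Gamma (- \<alpha>)"
    using Gamma_plus1[of "- \<alpha>"] by (simp add: add.commute)
  then have "(Gamma \<alpha> * Gamma (- \<alpha>)) * (- \<alpha>) = pi / (2 * sin \<theta> * cos \<theta>)"
    using Gamma_reflection_real[of \<alpha>] sin_double[of \<theta>] by (simp add: \<theta>_def mult_ac)
  then have G: "Gamma \<alpha> * Gamma (- \<alpha>) = pi / (2 * sin \<theta> * cos \<theta>) / (- \<alpha>)"
    by (rule eq_divide_imp[rotated]) (use \<alpha> in simp)
  have "(cp + cm) * (1 - stable_skewness cp cm) = 2 * cm"
    using c(3) by (simp add: stable_skewness_def field_simps)
  then have D: "- (cp + cm) * (1 - stable_skewness cp cm) = - 2 * cm" by (simp add: algebra_simps)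
  have "passage_constant \<alpha> cp cm \<rho>
      = - (cp + cm) * Gamma (- \<alpha>) * cos \<theta> * Gamma \<alpha> * (sqrt (1 + w\<^sup>2) * sin (pi * \<alpha> * \<rho>)) / pi"
    using assms(1) by (simp add: passage_constant_def stable_scale_def w_def \<theta>_def power_mult_distrib mult_ac)
  also have "\<dots> = (- (cp + cm) * (1 - stable_skewness cp cm)) * (Gamma \<alpha> * Gamma (- \<alpha>)) * (sin \<theta> * cos \<theta>) / pi"
    unfolding S by (simp add: algebra_simps)
  also have "\<dots> = cm / \<alpha>"
    unfolding D G using sin_pos cos_nz \<alpha> by (simp add: field_simps)
  finally show ?thesis .
qed

end

section \<open>Small times\<close>

text \<open>Mean value inequality on the left half-plane, which is convex and where |exp| is at most
  1.\<close>

lemma norm_exp_minus_1_le: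
  fixes z :: complex
  assumes "Re z \<le> 0"
  shows "norm (exp z - 1) \<le> norm z"
proof -
  have "norm (exp z - exp 0) \<le> 1 * norm (z - 0)"
  proof (rule field_differentiable_bound[where S = "{z. Re z \<le> 0}" and f' = exp])
    show "convex {z. Re z \<le> 0}"
      by (rule convex_halfspace_Re_le)
  qed (use assms in \<open>auto intro: DERIV_subset[OF DERIV_exp]\<close>)
  then show ?thesis by simp
qed

text \<open>Normalises a tilted measure to a probability. It serves both for the small-time laws,
  with g the weight, and for the Levy measure over \<open>lborel\<close>, with g the weight times
  the density.\<close>

lemma weighted_distribution:
  fixes M :: "real measure" and g :: "real \<Rightarrow> real"
  assumes M: "sets M = sets borel" and [measurable]: "g \<in> borel_measurable borel" and g: "\<And>y. 0 \<le> g y"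
    and int: "integrable M g" "(LINT y|M. g y) = c" "0 < c"
  shows "real_distribution (density M (\<lambda>y. ennreal (g y / c)))"
    and "char (density M (\<lambda>y. ennreal (g y / c))) u = (CLINT y|M. g y *\<^sub>R iexp (u * y)) / of_real c"
    and "A \<in> sets borel \<Longrightarrow> measure (density M (\<lambda>y. ennreal (g y / c))) A = (LINT y|M. g y * indicator A y) / c"
proof -
  have meas: "f \<in> borel_measurable M" if "f \<in> borel_measurable borel" for f :: "real \<Rightarrow> 'b::topological_space"
    using that measurable_cong_sets[OF M refl] by blast
  have gM: "(\<lambda>y. g y / c) \<in> borel_measurable M"
    by (rule meas) measurable
  have "emeasure (density M (\<lambda>y. ennreal (g y / c))) (space M) = (\<integral>\<^sup>+y. ennreal (g y / c) \<partial>M)"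
    using gM by (simp add: emeasure_density cong: nn_integral_cong)
  also have "\<dots> = ennreal (LINT y|M. g y / c)"
    using int g by (intro nn_integral_eq_integral) auto
  finally have "prob_space (density M (\<lambda>y. ennreal (g y / c)))"
    using int by (intro prob_spaceI) simp
  then show R: "real_distribution (density M (\<lambda>y. ennreal (g y / c)))"
    using M by (simp add: real_distribution_def real_distribution_axioms_def)
  have "char (density M (\<lambda>y. ennreal (g y / c))) u = (CLINT y|M. (g y / c) *\<^sub>R iexp (u * y))"
    unfolding char_def using g int gM by (intro integral_density meas) auto
  also have "\<dots> = (CLINT y|M. (g y *\<^sub>R iexp (u * y)) / of_real c)"
    by (intro Bochner_Integration.integral_cong) (auto simp: scaleR_conv_of_real)
  finally show "char (density M (\<lambda>y. ennreal (g y / c))) u = (CLINT y|M. g y *\<^sub>R iexp (u * y)) / of_real c"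
    by simp
  assume [measurable]: "A \<in> sets borel"
  interpret R: real_distribution "density M (\<lambda>y. ennreal (g y / c))" by (rule R)
  have "measure (density M (\<lambda>y. ennreal (g y / c))) A = (LINT y|density M (\<lambda>y. ennreal (g y / c)). indicator A y)"
    using sets_eq_imp_space_eq[OF M] by simp
  also have "\<dots> = (LINT y|M. (g y / c) *\<^sub>R indicator A y)"
    using g int gM by (intro integral_density meas) auto
  also have "\<dots> = (LINT y|M. (g y * indicator A y) / c)"
    by simp
  finally show "measure (density M (\<lambda>y. ennreal (g y / c))) A = (LINT y|M. g y * indicator A y) / c"
    by simp
qed

section \<open>Tail and window estimates for the law at a small time\<close>

context stable_parameters
begin

text \<open>1 - E exp (-Y^2/2) is the Gaussian average of 1 - \<open>char\<close>, hence at most t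
  times that of D (1 + u^2), which is 2 D t since the second moment is 1. On the tail 1 - exp
  (-y^2/2) is at least \<open>\<kappa>\<close>, so Markov's inequality gives C = 2 D / \<kappa>, the
  same for all t and M.\<close>

lemma exponent_tail_bound:
  assumes "0 < \<epsilon>"
  shows "\<exists>C\<ge>0. \<forall>t\<ge>0. \<forall>M. real_distribution M \<longrightarrow> (\<forall>u. char M u = exp (of_real t * \<psi> u)) \<longrightarrow>
    measure M {y. \<epsilon> \<le> \<bar>y\<bar>} \<le> C * t"
proof -
  obtain D where D: "\<And>u. norm (\<psi> u) \<le> D * (1 + u\<^sup>2)" using norm_exponent_le by blast
  have D0: "0 \<le> D" using D[of 0] norm_ge_zero[of "\<psi> 0"] by (simp del: norm_ge_zero)
  define \<kappa> where "\<kappa> = 1 - exp (- \<epsilon>\<^sup>2 / 2)"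
  have \<kappa>: "0 < \<kappa>" using assms by (simp add: \<kappa>_def)
  interpret N: real_distribution std_normal_distribution by (rule real_dist_normal_dist)
  have "measure M {y. \<epsilon> \<le> \<bar>y\<bar>} \<le> (2 * D / \<kappa>) * t"
    if "0 \<le> t" "real_distribution M" and char: "\<And>u. char M u = exp (of_real t * \<psi> u)" for t M
  proof -
    interpret real_distribution M by fact
    have m2: "integrable std_normal_distribution (\<lambda>u. u\<^sup>2)" "(LINT u|std_normal_distribution. u\<^sup>2) = 1"
      using integrable_std_normal_distribution_moment[of 2] std_normal_distribution_even_moments(1)[of 1] by (auto simp: fact_numeral)
    have bound: "norm (1 - char M u) \<le> t * (D * (1 + u\<^sup>2))" for u
    proof -
      have "norm (1 - char M u) \<le> norm (of_real t * \<psi> u)"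
        unfolding char norm_minus_commute[of 1]
        using \<open>0 \<le> t\<close> Re_exponent_le[of u] by (intro norm_exp_minus_1_le) (simp add: mult_nonneg_nonpos)
      also have "\<dots> \<le> t * (D * (1 + u\<^sup>2))"
        using \<open>0 \<le> t\<close> D[of u] by (simp add: norm_mult mult_left_mono)
      finally show ?thesis .
    qed
    have i1: "complex_integrable std_normal_distribution (\<lambda>u. char M u)"
      by (intro N.integrable_const_bound[of _ 1]) (auto simp: cmod_char_le_1)
    have i2: "integrable M (\<lambda>y. exp (- y\<^sup>2 / 2))"
      by (intro integrable_const_bound[of _ 1]) auto
    have "complex_of_real (1 - (LINT y|M. exp (- y\<^sup>2 / 2))) = (CLINT u|std_normal_distribution. 1 - char M u)"
      using gaussian_smoothing[of 1] i1 N.prob_space by simp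
    then have "\<bar>1 - (LINT y|M. exp (- y\<^sup>2 / 2))\<bar> = norm (CLINT u|std_normal_distribution. 1 - char M u)"
      by (metis norm_of_real)
    also have "\<dots> \<le> (LINT u|std_normal_distribution. norm (1 - char M u))"
      by (rule integral_norm_bound)
    also have "\<dots> \<le> (LINT u|std_normal_distribution. t * (D * (1 + u\<^sup>2)))"
      using bound i1 m2 by (intro integral_mono) auto
    also have "\<dots> = t * (D * 2)"
      using m2 N.prob_space by simp
    finally have 1: "1 - (LINT y|M. exp (- y\<^sup>2 / 2)) \<le> 2 * D * t" by (simp add: mult_ac)
    have "\<kappa> * measure M {y. \<epsilon> \<le> \<bar>y\<bar>} = (LINT y|M. \<kappa> * indicator {y. \<epsilon> \<le> \<bar>y\<bar>} y)"
      by simp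
    also have "\<dots> \<le> (LINT y|M. 1 - exp (- y\<^sup>2 / 2))"
    proof (rule integral_mono)
      show "integrable M (\<lambda>y. \<kappa> * indicator {y. \<epsilon> \<le> \<bar>y\<bar>} y)"
        using \<kappa> by (intro integrable_const_bound[of _ \<kappa>]) (auto simp: indicator_def)
      fix y :: real
      have "\<epsilon>\<^sup>2 \<le> y\<^sup>2" if "\<epsilon> \<le> \<bar>y\<bar>" using that assms by (metis abs_le_square_iff abs_of_pos)
      then show "\<kappa> * indicator {y. \<epsilon> \<le> \<bar>y\<bar>} y \<le> 1 - exp (- y\<^sup>2 / 2)"
        by (auto simp: \<kappa>_def indicator_def)
    qed (use i2 in auto)
    also have "\<dots> = 1 - (LINT y|M. exp (- y\<^sup>2 / 2))"
      using i2 prob_space by simp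
    finally have "\<kappa> * measure M {y. \<epsilon> \<le> \<bar>y\<bar>} \<le> 2 * D * t" using 1 by linarith
    then show ?thesis using \<kappa> by (simp add: field_simps)
  qed
  moreover have "0 \<le> 2 * D / \<kappa>" using D0 \<kappa> by simp
  ultimately show ?thesis by blast
qed

text \<open>
  As \<open>t\<close> tends to \<open>0\<close>, the measures \<open>(1 - cos (y / x)) \<mu>\<^sub>t(dy) / t\<close> converge weakly to
  \<open>(1 - cos (y / x)) \<nu>(y) dy\<close>, because second differences of the exponent are the Fourier transform of the
  latter. The limit has no atom at \<open>- x\<close>, where the weight is bounded away from \<open>0\<close>.
\<close>

lemma exponent_window_bound:
  assumes \<mu>: "\<And>t. 0 < t \<Longrightarrow> real_distribution (\<mu> t)"
    and char: "\<And>t u. 0 < t \<Longrightarrow> char (\<mu> t) u = exp (of_real t * \<psi> u)"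
    and "0 < x" "0 < e" "0 < d"
  shows "\<exists>\<delta>>0. \<delta> \<le> d \<and> (\<forall>\<^sub>F t in at_right 0. measure (\<mu> t) {- x<..- x + \<delta>} \<le> e * t)"
proof -
  \<comment> \<open>This frequency makes |\<eta> y| run through [1/2, 1] as y runs through
    [-x, -x/2], so the weight stays away from 0 there.\<close>
  define \<eta> where "\<eta> = 1 / x"
  define w where "w y = 1 - cos (\<eta> * y)" for y
  define m where "m = - Re (\<psi> \<eta>)"
  have w: "0 \<le> w y" "w y \<le> 2" for y
    using cos_ge_minus_one[of "\<eta> * y"] by (auto simp: w_def simp del: cos_ge_minus_one)
  have [measurable]: "w \<in> borel_measurable borel" unfolding w_def by measurable
  have m: "0 < m" using Re_exponent_neg[of \<eta>] \<open>0 < x\<close> by (simp add: m_def \<eta>_def)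
  have m_eq: "(LINT y|lborel. \<nu> y * w y) = m"
    unfolding m_def Re_exponent w_def by simp
  have int: "integrable lborel (\<lambda>y. \<nu> y * w y)"
    using one_minus_cos_integrable[of \<eta>] by (simp add: w_def)
  define N where "N = density lborel (\<lambda>y. ennreal (\<nu> y * w y / m))"
  have \<nu>w: "0 \<le> \<nu> y * w y" for y
    using stable_levy_density_nonneg[OF c(1,2)] w by simp
  note tilt = weighted_distribution[OF sets_lborel _ \<nu>w int m_eq m, folded N_def]
  have N: "real_distribution N" by (rule tilt(1)) measurable
  interpret N: real_distribution N by (rule N)
  have char_N: "char N u = (\<psi> u - (\<psi> (u + \<eta>) + \<psi> (u - \<eta>)) / 2) / of_real m" for u
    unfolding exponent_second_difference w_def[symmetric] by (rule tilt(2)) measurable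
  have "measure N {a} = 0" for a
  proof -
    have "measure N {a} = (LINT y|lborel. \<nu> y * w y * indicator {a} y) / m"
      by (rule tilt(3)) measurable
    also have "(LINT y|lborel. \<nu> y * w y * indicator {a} y) = 0"
      using AE_lborel_singleton[of a] by (intro integral_eq_zero_AE) auto
    finally show ?thesis by simp
  qed
  then have cont: "isCont (cdf N) a" for a
    by (simp add: N.isCont_cdf)

  \<comment> \<open>The total mass of the tilted law, that is, the integral of \<open>w\<close>
    under \<open>\<mu> t\<close>, written through the characteristic function so that its behaviour
    as t tends to 0 can be read off.\<close>
  define r where "r t = - Re (char (\<mu> t) \<eta> - 1)" for t
  define \<mu>' where "\<mu>' t = density (\<mu> t) (\<lambda>y. ennreal (w y / r t))" for t
  have r_pos: "0 < r t" if "0 < t" for t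
  proof -
    have "Re (char (\<mu> t) \<eta>) \<le> norm (char (\<mu> t) \<eta>)" by (rule complex_Re_le_cmod)
    also have "\<dots> = exp (t * Re (\<psi> \<eta>))" by (simp add: char[OF that])
    also have "\<dots> < 1" using m that by (simp add: m_def mult_pos_neg)
    finally show ?thesis by (simp add: r_def)
  qed
  have \<mu>': "real_distribution (\<mu>' t)"
    "char (\<mu>' t) u = (char (\<mu> t) u - (char (\<mu> t) (u + \<eta>) + char (\<mu> t) (u - \<eta>)) / 2) / of_real (r t)"
    "A \<in> sets borel \<Longrightarrow> measure (\<mu>' t) A = (LINT y|\<mu> t. w y * indicator A y) / r t"
    if "0 < t" for t u A
  proof -
    interpret real_distribution "\<mu> t" by (rule \<mu>[OF that])
    have iw: "integrable (\<mu> t) w"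
      using w by (intro integrable_const_bound[of _ 2]) auto
    have ie: "complex_integrable (\<mu> t) (\<lambda>y. iexp (v * y))" for v
      by (intro integrable_const_bound[of _ 1]) auto
    have "Re (char (\<mu> t) \<eta>) = (LINT y|\<mu> t. cos (\<eta> * y))"
      unfolding char_def using integral_Re[OF ie[of \<eta>]] by (simp add: Re_exp)
    moreover have "integrable (\<mu> t) (\<lambda>y. cos (\<eta> * y))"
      by (intro integrable_const_bound[of _ 1]) auto
    ultimately have rt: "(LINT y|\<mu> t. w y) = r t"
      unfolding w_def r_def using prob_space by simp
    note T = weighted_distribution[OF events_eq_borel _ w(1) iw rt r_pos[OF that], folded \<mu>'_def]
    show "real_distribution (\<mu>' t)" by (rule T(1)) measurable
    show "A \<in> sets borel \<Longrightarrow> measure (\<mu>' t) A = (LINT y|\<mu> t. w y * indicator A y) / r t"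
      by (rule T(3)) simp_all
    have "(CLINT y|\<mu> t. w y *\<^sub>R iexp (u * y)) = (CLINT y|\<mu> t. iexp (u * y) - (iexp ((u + \<eta>) * y) + iexp ((u - \<eta>) * y)) / 2)"
    proof (intro Bochner_Integration.integral_cong refl)
      fix y
      have "iexp ((u + \<eta>) * y) + iexp ((u - \<eta>) * y) = iexp (u * y) * (2 * cos (of_real (\<eta> * y)))"
        by (simp add: cos_exp_eq algebra_simps flip: exp_add)
      then have "iexp ((u + \<eta>) * y) + iexp ((u - \<eta>) * y) = iexp (u * y) * (2 * of_real (cos (\<eta> * y)))"
        by (simp only: cos_of_real)
      then show "w y *\<^sub>R iexp (u * y) = iexp (u * y) - (iexp ((u + \<eta>) * y) + iexp ((u - \<eta>) * y)) / 2"
        by (simp add: w_def scaleR_conv_of_real algebra_simps)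
    qed
    also have "\<dots> = char (\<mu> t) u - (char (\<mu> t) (u + \<eta>) + char (\<mu> t) (u - \<eta>)) / 2"
      unfolding char_def using ie[of u] ie[of "u + \<eta>"] ie[of "u - \<eta>"] by simp
    finally show "char (\<mu>' t) u = (char (\<mu> t) u - (char (\<mu> t) (u + \<eta>) + char (\<mu> t) (u - \<eta>)) / 2) / of_real (r t)"
      using T(2)[of u] by simp
  qed

  \<comment> \<open>The complex derivative of exp (z \<psi>(u)) at 0, approached along the positive
    reals.\<close>
  have der: "((\<lambda>t. (char (\<mu> t) u - 1) / of_real t) \<longlongrightarrow> \<psi> u) (at_right 0)" for u
  proof -
    have "((\<lambda>z. exp (z * \<psi> u)) has_field_derivative exp (0 * \<psi> u) * \<psi> u) (at 0)"
      by (auto intro!: derivative_eq_intros)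
    then have "((\<lambda>z. (exp (z * \<psi> u) - 1) / z) \<longlongrightarrow> \<psi> u) (at 0)"
      by (simp add: has_field_derivative_iff)
    moreover have "filterlim complex_of_real (at 0) (at_right 0)"
      by (intro filterlim_atI tendsto_eq_intros) (auto simp: eventually_at_filter)
    ultimately have "((\<lambda>t. (exp (of_real t * \<psi> u) - 1) / complex_of_real t) \<longlongrightarrow> \<psi> u) (at_right 0)"
      by (rule filterlim_compose)
    then show ?thesis
      by (rule Lim_transform_eventually) (auto simp: char eventually_at_right_less intro!: eventually_mono[OF eventually_at_right_less])
  qed
  have r_lim: "((\<lambda>t. r t / t) \<longlongrightarrow> m) (at_right 0)"
  proof -
    have "((\<lambda>t. - Re ((char (\<mu> t) \<eta> - 1) / of_real t)) \<longlongrightarrow> - Re (\<psi> \<eta>)) (at_right 0)"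
      by (intro tendsto_intros der)
    then show ?thesis by (simp add: r_def m_def diff_divide_distrib minus_divide_left)
  qed
  \<comment> \<open>Dividing both the second difference and the total mass by t leaves their
    quotient unchanged and turns them into difference quotients; the constants -1 cancel in the
    second difference.\<close>
  have char_lim: "((\<lambda>t. char (\<mu>' t) u) \<longlongrightarrow> char N u) (at_right 0)" for u
  proof -
    let ?q = "\<lambda>t v. (char (\<mu> t) v - 1) / of_real t"
    have "((\<lambda>t. (?q t u - (?q t (u + \<eta>) + ?q t (u - \<eta>)) / 2) / of_real (r t / t))
        \<longlongrightarrow> (\<psi> u - (\<psi> (u + \<eta>) + \<psi> (u - \<eta>)) / 2) / of_real m) (at_right 0)"
      using m by (intro tendsto_intros der r_lim) auto
    then show ?thesis
      unfolding char_N
    proof (rule Lim_transform_eventually)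
      show "\<forall>\<^sub>F t in at_right 0. (?q t u - (?q t (u + \<eta>) + ?q t (u - \<eta>)) / 2) / of_real (r t / t) = char (\<mu>' t) u"
        using eventually_at_right_less[of 0]
      proof eventually_elim
        case (elim t)
        have "?q t u - (?q t (u + \<eta>) + ?q t (u - \<eta>)) / 2
            = (char (\<mu> t) u - (char (\<mu> t) (u + \<eta>) + char (\<mu> t) (u - \<eta>)) / 2) / of_real t"
          using elim by (simp add: field_simps)
        then show ?case
          using elim r_pos[OF elim] by (simp add: \<mu>'(2))
      qed
    qed
  qed
  \<comment> \<open>Levy's continuity theorem is about sequences, so the right limit is tested along
    positive times tending to 0. Every point is a continuity point of \<open>cdf N\<close>, since
    \<open>N\<close> has a density.\<close>
  have measure_lim: "((\<lambda>t. measure (\<mu>' t) {a<..b}) \<longlongrightarrow> measure N {a<..b}) (at_right 0)" if "a < b" for a b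
  proof (rule tendsto_at_right_sequentially[of 0 1])
    fix S :: "nat \<Rightarrow> real"
    assume S: "\<And>n. 0 < S n" "S \<longlonglongrightarrow> 0"
    then have S0: "filterlim S (at_right 0) sequentially"
      by (intro tendsto_imp_filterlim_at_right always_eventually allI)
    have "weak_conv_m (\<lambda>n. \<mu>' (S n)) N"
      using S by (intro levy_continuity \<mu>'(1) N filterlim_compose[OF char_lim S0])
    then have "(\<lambda>n. cdf (\<mu>' (S n)) z) \<longlonglongrightarrow> cdf N z" for z
      using cont by (simp add: weak_conv_m_def weak_conv_def)
    then have "(\<lambda>n. cdf (\<mu>' (S n)) b - cdf (\<mu>' (S n)) a) \<longlonglongrightarrow> cdf N b - cdf N a"
      by (intro tendsto_intros)
    moreover have "cdf (\<mu>' (S n)) b - cdf (\<mu>' (S n)) a = measure (\<mu>' (S n)) {a<..b}" for n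
      by (intro finite_borel_measure.cdf_diff_eq real_distribution.finite_borel_measure_M \<mu>'(1) S that)
    ultimately show "(\<lambda>n. measure (\<mu>' (S n)) {a<..b}) \<longlonglongrightarrow> measure N {a<..b}"
      using N.cdf_diff_eq[OF that] by simp
  qed simp

  define \<kappa> where "\<kappa> = 1 - cos (1 / 2 :: real)"
  have \<kappa>: "0 < \<kappa>"
    using cos_monotone_0_pi[of 0 "1 / 2"] pi_gt3 by (simp add: \<kappa>_def)
  \<comment> \<open>Continuity of the limit at -x supplies the window: its limiting mass falls below
    \<open>e * \<kappa>\<close>, where \<open>\<kappa>\<close> pays for removing the weight at the
    end.\<close>
  have "((\<lambda>\<delta>. m * (cdf N (- x + \<delta>) - cdf N (- x))) \<longlongrightarrow> m * (cdf N (- x + 0) - cdf N (- x))) (at_right 0)"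
    by (intro tendsto_intros isCont_tendsto_compose[OF cont])
  then have "\<forall>\<^sub>F \<delta> in at_right 0. m * (cdf N (- x + \<delta>) - cdf N (- x)) < e * \<kappa>"
    using \<open>0 < e\<close> \<kappa> by (intro order_tendstoD(2)) auto
  moreover have "\<forall>\<^sub>F \<delta> in at_right 0. 0 < \<delta> \<and> \<delta> < min d (x / 2)"
    using assms by (intro eventually_at_rightI[of 0 "min d (x / 2)"]) auto
  ultimately have "\<forall>\<^sub>F \<delta> in at_right 0. m * (cdf N (- x + \<delta>) - cdf N (- x)) < e * \<kappa> \<and> 0 < \<delta> \<and> \<delta> < min d (x / 2)"
    by eventually_elim auto
  then obtain \<delta> where \<delta>: "m * (cdf N (- x + \<delta>) - cdf N (- x)) < e * \<kappa>" "0 < \<delta>" "\<delta> < d" "\<delta> < x / 2"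
    using eventually_happens'[OF trivial_limit_at_right_real] by auto
  let ?I = "{- x<..- x + \<delta>}"
  have w_ge: "\<kappa> \<le> w y" if "y \<in> ?I" for y
  proof -
    have "\<bar>\<eta> * y\<bar> \<le> 1" "1 / 2 \<le> \<bar>\<eta> * y\<bar>"
      using that \<delta> \<open>0 < x\<close> by (auto simp: \<eta>_def abs_mult field_simps)
    then have "cos \<bar>\<eta> * y\<bar> \<le> cos (1 / 2)"
      using pi_gt3 by (intro cos_monotone_0_pi_le) auto
    then show ?thesis by (simp add: w_def \<kappa>_def)
  qed
  have "((\<lambda>t. r t / t * measure (\<mu>' t) ?I) \<longlongrightarrow> m * measure N ?I) (at_right 0)"
    using \<delta> by (intro tendsto_intros r_lim measure_lim) auto
  moreover have "m * measure N ?I < e * \<kappa>"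
    using \<delta> N.cdf_diff_eq[of "- x" "- x + \<delta>"] by simp
  ultimately have "\<forall>\<^sub>F t in at_right 0. r t / t * measure (\<mu>' t) ?I < e * \<kappa>"
    by (rule order_tendstoD(2))
  then have "\<forall>\<^sub>F t in at_right 0. measure (\<mu> t) ?I \<le> e * t"
    using eventually_at_right_less[of 0]
  proof eventually_elim
    case (elim t)
    interpret real_distribution "\<mu> t" by (rule \<mu>[OF elim(2)])
    \<comment> \<open>The tilt is undone here: on the window \<open>w\<close> is at least
      \<open>\<kappa>\<close>.\<close>
    have "\<kappa> * measure (\<mu> t) ?I = (LINT y|\<mu> t. \<kappa> * indicator ?I y)"
      by simp
    also have "\<dots> \<le> (LINT y|\<mu> t. w y * indicator ?I y)"
    proof (intro integral_mono integrable_const_bound[of _ "2 + \<kappa>"] AE_I2)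
      fix y
      have "w y \<le> 2 + \<kappa>" using w(2)[of y] \<kappa> by linarith
      then show "norm (\<kappa> * indicator ?I y) \<le> 2 + \<kappa>" "norm (w y * indicator ?I y) \<le> 2 + \<kappa>"
        "\<kappa> * indicator ?I y \<le> w y * indicator ?I y"
        using w(1)[of y] \<kappa> w_ge[of y] by (auto simp: indicator_def)
    qed auto
    also have "\<dots> = r t * measure (\<mu>' t) ?I"
      using r_pos[OF elim(2)] by (simp add: \<mu>'(3)[OF elim(2)])
    also have "\<dots> \<le> e * \<kappa> * t"
      using elim by (simp add: field_simps)
    finally show ?case
      using \<kappa> by (simp add: field_simps)
  qed
  with \<delta> show ?thesis by (intro exI[of _ \<delta>]) auto
qed

end

section \<open>Passage below zero and return\<close>

text \<open>The first-passage event depends on the steps before k, the later increment on those from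
  k on, and disjoint blocks of independent steps are independent. \<open>Y1\<close> encodes the
  event as a 0/1-valued variable, so that independence of real random variables can be
  applied.\<close>

lemma (in prob_space) first_passage_indep:
  fixes D :: "nat \<Rightarrow> 'a \<Rightarrow> real"
  assumes indep: "indep_vars (\<lambda>_. borel) D {..<n}" and "k \<le> n" and B: "B \<in> sets borel"
  defines "S \<equiv> \<lambda>k \<omega>. \<Sum>i<k. D i \<omega>"
  shows "\<P>(\<omega> in M. (S k \<omega> < a \<and> (\<forall>j<k. a \<le> S j \<omega>)) \<and> S n \<omega> - S k \<omega> \<in> B)
    = \<P>(\<omega> in M. S k \<omega> < a \<and> (\<forall>j<k. a \<le> S j \<omega>)) * \<P>(\<omega> in M. S n \<omega> - S k \<omega> \<in> B)"
proof -
  define Q where "Q f \<longleftrightarrow> (\<Sum>i<k. f i) < a \<and> (\<forall>j\<in>{..<k}. a \<le> (\<Sum>i<j. f i))" for f :: "nat \<Rightarrow> real"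
  define Y1 where "Y1 f = (if Q f then 1 else 0 :: real)" for f
  define Y2 where "Y2 f = (\<Sum>i\<in>{k..<n}. f i)" for f :: "nat \<Rightarrow> real"
  have sum_meas: "(\<lambda>f. \<Sum>i<j. f i :: real) \<in> borel_measurable (Pi\<^sub>M {..<k} (\<lambda>_. borel))" if "j \<le> k" for j
    by (rule borel_measurable_sum[where f = "\<lambda>i g. g i"]) (use that in \<open>auto intro!: measurable_component_singleton\<close>)
  have "Measurable.pred (Pi\<^sub>M {..<k} (\<lambda>_. borel)) Q"
    unfolding Q_def
  proof (intro pred_intros_logic pred_intros_finite)
    show "Measurable.pred (Pi\<^sub>M {..<k} (\<lambda>_. borel)) (\<lambda>f. (\<Sum>i<k. f i) < a)"
      using sum_meas[of k] by measurable
    show "Measurable.pred (Pi\<^sub>M {..<k} (\<lambda>_. borel)) (\<lambda>f. a \<le> (\<Sum>i<j. f i))" if "j \<in> {..<k}" for j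
    proof -
      have [measurable]: "(\<lambda>f. \<Sum>i<j. f i :: real) \<in> borel_measurable (Pi\<^sub>M {..<k} (\<lambda>_. borel))"
        using sum_meas[of j] that by simp
      show ?thesis by measurable
    qed
  qed simp
  then have Y1: "Y1 \<in> borel_measurable (Pi\<^sub>M {..<k} (\<lambda>_. borel))"
    unfolding Y1_def by measurable
  have Y2: "Y2 \<in> borel_measurable (Pi\<^sub>M {k..<n} (\<lambda>_. borel))"
    unfolding Y2_def by (rule borel_measurable_sum[where f = "\<lambda>i g. g i"]) (auto intro!: measurable_component_singleton)
  have "indep_var (Pi\<^sub>M {..<k} (\<lambda>_. borel)) (\<lambda>\<omega>. restrict (\<lambda>i. D i \<omega>) {..<k})
      (Pi\<^sub>M {k..<n} (\<lambda>_. borel)) (\<lambda>\<omega>. restrict (\<lambda>i. D i \<omega>) {k..<n})"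
    using \<open>k \<le> n\<close> by (intro indep_var_restrict[OF indep]) auto
  from indep_var_compose[OF this Y1 Y2]
  have "indep_var borel (\<lambda>\<omega>. Y1 (restrict (\<lambda>i. D i \<omega>) {..<k})) borel (\<lambda>\<omega>. Y2 (restrict (\<lambda>i. D i \<omega>) {k..<n}))"
    by (simp add: comp_def)
  from prob_indep_random_variable[OF this, of "{1}" B] B
  have "\<P>(\<omega> in M. Y1 (restrict (\<lambda>i. D i \<omega>) {..<k}) = 1 \<and> Y2 (restrict (\<lambda>i. D i \<omega>) {k..<n}) \<in> B)
      = \<P>(\<omega> in M. Y1 (restrict (\<lambda>i. D i \<omega>) {..<k}) = 1) * \<P>(\<omega> in M. Y2 (restrict (\<lambda>i. D i \<omega>) {k..<n}) \<in> B)"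
    by simp
  moreover have "Y1 (restrict (\<lambda>i. D i \<omega>) {..<k}) = 1 \<longleftrightarrow> S k \<omega> < a \<and> (\<forall>j<k. a \<le> S j \<omega>)" for \<omega>
    by (auto simp: Y1_def Q_def S_def)
  moreover have "Y2 (restrict (\<lambda>i. D i \<omega>) {k..<n}) = S n \<omega> - S k \<omega>" for \<omega>
    using sum_diff_nat_ivl[of 0 k n "\<lambda>i. D i \<omega>"] \<open>k \<le> n\<close> by (simp add: Y2_def S_def atLeast0LessThan)
  ultimately show ?thesis
    by simp
qed

text \<open>By Ottaviani's inequality the walk drops below \<open>a\<close> with probability at most
  \<open>p / (1 - p)\<close>; independently of that it then has to rise by \<open>\<delta>\<close>.\<close>

lemma (in prob_space) first_passage_return_bound:
  fixes D :: "nat \<Rightarrow> 'a \<Rightarrow> real"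
  assumes indep: "indep_vars (\<lambda>_. borel) D {..<n}" and p: "0 \<le> p" "p < 1" and "0 < \<delta>" "a \<le> - 2 * \<delta>"
  defines "S \<equiv> \<lambda>k \<omega>. \<Sum>i<k. D i \<omega>"
  assumes inc: "\<And>k. k \<le> n \<Longrightarrow> \<P>(\<omega> in M. \<delta> \<le> \<bar>S n \<omega> - S k \<omega>\<bar>) \<le> p"
  shows "\<P>(\<omega> in M. (\<exists>k\<le>n. S k \<omega> < a) \<and> a + \<delta> < S n \<omega>) \<le> p * (p / (1 - p))"
proof -
  have D_meas: "random_variable borel (D i)" if "i < n" for i
    using indep that by (auto simp: indep_vars_def)
  have [measurable]: "random_variable borel (S k)" if "k \<le> n" for k
    unfolding S_def using that by (intro borel_measurable_sum D_meas) auto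
  \<comment> \<open>Splitting by the first passage index makes the pieces disjoint and each
    independent of the steps that follow.\<close>
  define A where "A k = {\<omega> \<in> space M. S k \<omega> < a \<and> (\<forall>j<k. a \<le> S j \<omega>)}" for k
  define F where "F = {\<omega> \<in> space M. \<exists>k\<le>n. S k \<omega> < a}"
  have S_sets: "{\<omega> \<in> space M. S n \<omega> - S k \<omega> \<in> B} \<in> events" if "k \<le> n" "B \<in> sets borel" for k B
    using that by measurable
  have A_sets: "A k \<in> events" if "k \<le> n" for k
  proof -
    have "A k = {\<omega> \<in> space M. S k \<omega> < a} \<inter> (\<Inter>j\<in>{..<k}. {\<omega> \<in> space M. a \<le> S j \<omega>}) \<inter> space M"
      by (auto simp: A_def)
    also have "\<dots> \<in> events"
    proof (cases "k = 0")
      case False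
      then show ?thesis using that by (intro sets.Int sets.finite_INT) auto
    qed (use that in simp)
    finally show ?thesis .
  qed
  have disj: "disjoint_family_on A {..n}"
  proof -
    have "False" if "\<omega> \<in> A j" "\<omega> \<in> A k" "j < k" for j k \<omega>
      using that by (fastforce simp: A_def)
    then show ?thesis
      unfolding disjoint_family_on_def by (metis disjoint_iff linorder_neqE_nat)
  qed
  have F_eq: "F = (\<Union>k\<in>{..n}. A k)"
  proof
    show "F \<subseteq> (\<Union>k\<in>{..n}. A k)"
    proof
      fix \<omega> assume "\<omega> \<in> F"
      then obtain k where k: "\<omega> \<in> space M" "k \<le> n" "S k \<omega> < a" by (auto simp: F_def)
      define l where "l = (LEAST k. S k \<omega> < a)"
      have "S l \<omega> < a" unfolding l_def by (rule LeastI[of _ k]) (rule k(3))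
      moreover have "l \<le> k" unfolding l_def by (rule Least_le) (rule k(3))
      moreover have "a \<le> S j \<omega>" if "j < l" for j
        using not_less_Least[of j "\<lambda>k. S k \<omega> < a"] that unfolding l_def by (simp add: not_less)
      ultimately have "\<omega> \<in> A l" "l \<in> {..n}" using k by (simp_all add: A_def)
      then show "\<omega> \<in> (\<Union>k\<in>{..n}. A k)" by blast
    qed
  qed (auto simp: F_def A_def)
  have split: "prob {\<omega> \<in> F. R \<omega>} = (\<Sum>k\<le>n. prob {\<omega> \<in> A k. R \<omega>})" if "{\<omega> \<in> space M. R \<omega>} \<in> events" for R
  proof -
    have eq: "{\<omega> \<in> A k. R \<omega>} = A k \<inter> {\<omega> \<in> space M. R \<omega>}" for k by (auto simp: A_def)
    have "{\<omega> \<in> F. R \<omega>} = (\<Union>k\<in>{..n}. {\<omega> \<in> A k. R \<omega>})" unfolding F_eq by auto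
    also have "prob \<dots> = (\<Sum>k\<le>n. prob {\<omega> \<in> A k. R \<omega>})"
    proof (rule finite_measure_finite_Union)
      show "(\<lambda>k. {\<omega> \<in> A k. R \<omega>}) ` {..n} \<subseteq> events"
        unfolding eq using A_sets that by (auto intro!: sets.Int)
      show "disjoint_family_on (\<lambda>k. {\<omega> \<in> A k. R \<omega>}) {..n}"
        using disj by (auto simp: disjoint_family_on_def)
    qed simp
    finally show ?thesis .
  qed
  have prod: "prob {\<omega> \<in> A k. S n \<omega> - S k \<omega> \<in> B} = prob (A k) * \<P>(\<omega> in M. S n \<omega> - S k \<omega> \<in> B)"
    if "k \<le> n" "B \<in> sets borel" for k B
    using first_passage_indep[OF indep that, of a] by (simp add: A_def S_def conj_assoc)
  have q: "prob F = (\<Sum>k\<le>n. prob (A k))"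
    using split[of "\<lambda>_. True"] by simp

  \<comment> \<open>Ottaviani's step: after a first passage at k, a further rise below \<delta>
    keeps the end point below a + \<delta>, and independently of the past this has probability at
    least 1 - p.\<close>
  have "prob F * (1 - p) = (\<Sum>k\<le>n. prob (A k) * (1 - p))"
    unfolding q by (rule sum_distrib_right)
  also have "\<dots> \<le> (\<Sum>k\<le>n. prob {\<omega> \<in> A k. S n \<omega> < a + \<delta>})"
  proof (rule sum_mono)
    fix k assume "k \<in> {..n}"
    then have k: "k \<le> n" by simp
    have "1 - p \<le> \<P>(\<omega> in M. S n \<omega> - S k \<omega> \<in> {..<\<delta>})"
    proof -
      have "prob (space M - {\<omega> \<in> space M. S n \<omega> - S k \<omega> \<in> {..<\<delta>}}) \<le> \<P>(\<omega> in M. \<delta> \<le> \<bar>S n \<omega> - S k \<omega>\<bar>)"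
        using k by (intro finite_measure_mono) auto
      with inc[OF k] prob_compl[OF S_sets[OF k, of "{..<\<delta>}"]] show ?thesis by simp
    qed
    then have "prob (A k) * (1 - p) \<le> prob {\<omega> \<in> A k. S n \<omega> - S k \<omega> \<in> {..<\<delta>}}"
      using prod[OF k, of "{..<\<delta>}"] by (simp add: mult_left_mono)
    also have "\<dots> \<le> prob {\<omega> \<in> A k. S n \<omega> < a + \<delta>}"
    proof (rule finite_measure_mono)
      have "{\<omega> \<in> A k. S n \<omega> < a + \<delta>} = A k \<inter> {\<omega> \<in> space M. S n \<omega> < a + \<delta>}" by (auto simp: A_def)
      also have "\<dots> \<in> events" using A_sets[OF k] by (intro sets.Int) auto
      finally show "{\<omega> \<in> A k. S n \<omega> < a + \<delta>} \<in> events" .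
    qed (auto simp: A_def)
    finally show "prob (A k) * (1 - p) \<le> prob {\<omega> \<in> A k. S n \<omega> < a + \<delta>}" .
  qed
  also have "\<dots> = prob {\<omega> \<in> F. S n \<omega> < a + \<delta>}"
    by (rule split[symmetric]) measurable
  \<comment> \<open>The walk starts at 0 and a + \<delta> is at most -\<delta>, so ending below a +
    \<delta> is itself a displacement of size \<delta>.\<close>
  also have "\<dots> \<le> \<P>(\<omega> in M. \<delta> \<le> \<bar>S n \<omega> - S 0 \<omega>\<bar>)"
  proof (rule finite_measure_mono)
    show "{\<omega> \<in> F. S n \<omega> < a + \<delta>} \<subseteq> {\<omega> \<in> space M. \<delta> \<le> \<bar>S n \<omega> - S 0 \<omega>\<bar>}"
      using assms(4,5) by (auto simp: F_def S_def)
    show "{\<omega> \<in> space M. \<delta> \<le> \<bar>S n \<omega> - S 0 \<omega>\<bar>} \<in> events"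
      by measurable
  qed
  also have "\<dots> \<le> p" by (rule inc) simp
  finally have F_le: "prob F \<le> p / (1 - p)"
    using p by (simp add: pos_le_divide_eq)

  have "\<P>(\<omega> in M. (\<exists>k\<le>n. S k \<omega> < a) \<and> a + \<delta> < S n \<omega>) = prob {\<omega> \<in> F. a + \<delta> < S n \<omega>}"
    by (intro arg_cong[where f = prob]) (auto simp: F_def)
  also have "\<dots> = (\<Sum>k\<le>n. prob {\<omega> \<in> A k. a + \<delta> < S n \<omega>})"
    by (rule split) measurable
  \<comment> \<open>From below a to above a + \<delta> the walk must rise by more than \<delta>
    after k; this contributes the second factor p.\<close>
  also have "\<dots> \<le> (\<Sum>k\<le>n. p * prob (A k))"
  proof (rule sum_mono)
    fix k assume "k \<in> {..n}"
    then have k: "k \<le> n" by simp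
    have "{\<omega> \<in> A k. S n \<omega> - S k \<omega> \<in> {\<delta><..}} = A k \<inter> {\<omega> \<in> space M. S n \<omega> - S k \<omega> \<in> {\<delta><..}}" by (auto simp: A_def)
    also have "\<dots> \<in> events" using A_sets[OF k] S_sets[OF k, of "{\<delta><..}"] by (intro sets.Int) simp_all
    finally have "prob {\<omega> \<in> A k. a + \<delta> < S n \<omega>} \<le> prob {\<omega> \<in> A k. S n \<omega> - S k \<omega> \<in> {\<delta><..}}"
      by (intro finite_measure_mono) (auto simp: A_def)
    also have "\<dots> = prob (A k) * \<P>(\<omega> in M. S n \<omega> - S k \<omega> \<in> {\<delta><..})"
      by (rule prod[OF k]) simp
    also have "\<dots> \<le> prob (A k) * p"
    proof (rule mult_left_mono)
      have "\<P>(\<omega> in M. S n \<omega> - S k \<omega> \<in> {\<delta><..}) \<le> \<P>(\<omega> in M. \<delta> \<le> \<bar>S n \<omega> - S k \<omega>\<bar>)"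
        using k by (intro finite_measure_mono) auto
      also have "\<dots> \<le> p" by (rule inc[OF k])
      finally show "\<P>(\<omega> in M. S n \<omega> - S k \<omega> \<in> {\<delta><..}) \<le> p" .
    qed simp
    finally show "prob {\<omega> \<in> A k. a + \<delta> < S n \<omega>} \<le> p * prob (A k)"
      by (simp only: mult.commute)
  qed
  also have "\<dots> = p * prob F"
    unfolding q by (rule sum_distrib_left[symmetric])
  also have "\<dots> \<le> p * (p / (1 - p))"
    using F_le p by (intro mult_left_mono)
  finally show ?thesis .
qed

text \<open>If the path were positive before t, then g t > 0 and right continuity at t would keep it
  positive a little beyond t, and the infimum would exceed t. So some s < t has g s \<le> 0, and
  right continuity keeps g below \<delta> just after s, where a fine grid has a point. The level
  \<delta> > 0 is the price for moving from s to the grid.\<close>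

lemma cadlag_passage_dyadic:
  assumes g: "cadlag_on_nonneg g" and "0 < t" "0 < g t" "Inf {ereal s | s. 0 \<le> s \<and> g s \<le> 0} \<le> ereal t" "0 < \<delta>"
  shows "\<exists>m. \<exists>k\<le>2 ^ m. g (t * real k / 2 ^ m) < \<delta>"
proof -
  have right: "(g \<longlongrightarrow> g s) (at_right s)" if "0 \<le> s" for s
    using g that by (simp add: cadlag_on_nonneg_def)
  have "\<exists>s\<ge>0. s < t \<and> g s \<le> 0"
  proof (rule ccontr)
    assume none: "\<not> (\<exists>s\<ge>0. s < t \<and> g s \<le> 0)"
    have "\<forall>\<^sub>F s in at_right t. 0 < g s"
      using \<open>0 < t\<close> \<open>0 < g t\<close> by (intro order_tendstoD(1)[OF right]) auto
    then obtain b where b: "t < b" "\<And>s. t < s \<Longrightarrow> s < b \<Longrightarrow> 0 < g s"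
      by (auto simp: eventually_at_right_field)
    have "b \<le> s" if "0 \<le> s" "g s \<le> 0" for s
      using none that b(2)[of s] \<open>0 < g t\<close> by (cases s t rule: linorder_cases) (auto simp: not_less[symmetric])
    then have "ereal b \<le> Inf {ereal s | s. 0 \<le> s \<and> g s \<le> 0}"
      by (intro Inf_greatest) auto
    also note assms(4)
    finally show False using b(1) by simp
  qed
  then obtain s where s: "0 \<le> s" "s < t" "g s \<le> 0" by blast
  have "\<forall>\<^sub>F y in at_right s. g y < \<delta>"
    using s \<open>0 < \<delta>\<close> by (intro order_tendstoD(2)[OF right]) auto
  then obtain b' where b': "s < b'" "\<And>y. s < y \<Longrightarrow> y < b' \<Longrightarrow> g y < \<delta>"
    by (auto simp: eventually_at_right_field)
  \<comment> \<open>Capping at t keeps the grid point to be found within [0, t], that is,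
    \<open>k \<le> 2 ^ m\<close>.\<close>
  define b where "b = min b' t"
  have b: "s < b" "b \<le> t" "\<And>y. s < y \<Longrightarrow> y < b \<Longrightarrow> g y < \<delta>"
    using b' s by (auto simp: b_def)
  obtain m where m: "t / (b - s) < 2 ^ m"
    using real_arch_pow[of 2 "t / (b - s)"] by auto
  \<comment> \<open>The first grid index strictly after s; its grid point exceeds s by at most the
    mesh t / 2^m, which is less than b - s.\<close>
  define k where "k = nat (\<lfloor>2 ^ m * s / t\<rfloor> + 1)"
  have "real k = of_int \<lfloor>2 ^ m * s / t\<rfloor> + 1"
    using s \<open>0 < t\<close> by (simp add: k_def)
  then have "2 ^ m * s / t < real k" "real k \<le> 2 ^ m * s / t + 1"
    by linarith+
  then have k: "s < t * real k / 2 ^ m" "t * real k / 2 ^ m \<le> s + t / 2 ^ m"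
    using \<open>0 < t\<close> by (auto simp: field_simps)
  have "t / 2 ^ m < b - s"
    using m b(1) by (simp add: field_simps)
  with k have "t * real k / 2 ^ m < b" by linarith
  moreover have "k \<le> 2 ^ m"
  proof -
    have "t * (real k / 2 ^ m) < t * 1"
      using \<open>t * real k / 2 ^ m < b\<close> b(2) by simp
    then have "real k / 2 ^ m < 1"
      using \<open>0 < t\<close> by (simp only: mult_less_cancel_left_pos)
    then have "real k < real (2 ^ m)" by simp
    then show ?thesis by (simp only: of_nat_less_iff less_imp_le)
  qed
  ultimately show ?thesis
    using b(3) k(1) by blast
qed

text \<open>Lets a functional be estimated through a measurable cover of its support, without asking
  whether it is measurable: if it is not integrable, its Bochner integral is 0 and the bound is
  trivial.\<close>

lemma abs_expectation_completed_le:
  assumes "finite_measure M" "N \<in> sets M" "0 \<le> B"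
    and bound: "\<And>\<omega>. \<omega> \<in> space M \<Longrightarrow> \<bar>g \<omega>\<bar> \<le> B * indicator N \<omega>"
  shows "\<bar>expectation_completed M g\<bar> \<le> B * measure M N"
proof (cases "integrable (completion M) g")
  case True
  interpret finite_measure M by fact
  have "\<bar>expectation_completed M g\<bar> \<le> (LINT \<omega>|completion M. \<bar>g \<omega>\<bar>)"
    by (rule integral_abs_bound)
  also have "\<dots> \<le> (LINT \<omega>|completion M. B * indicator N \<omega>)"
    using True assms(2) bound
    by (intro integral_mono integrable_mult_right) (auto simp: integrable_indicator_iff emeasure_finite less_top[symmetric])
  also have "\<dots> = B * measure M N"
    using assms(2) by (simp add: Int_absorb2 sets.sets_into_space)
  finally show ?thesis .
next
  case False
  then show ?thesis using \<open>0 \<le> B\<close> by (simp add: not_integrable_integral_eq)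
qed

section \<open>Covering the passage event of a Levy path\<close>

context levy_process
begin

text \<open>Relative to its start, the path on the grid is a walk with independent steps, and level
  \<delta> for the path is level a = \<delta> - x for the walk; 3 \<delta> \<le> x says a \<le> -2
  \<delta>. By stationarity the increment from a grid time to t has the law of the displacement over
  the remaining time, to which the tail bound applies.\<close>

lemma grid_return_bound:
  assumes "0 < t" "0 < n" "0 < \<delta>" "3 * \<delta> \<le> x" "0 \<le> p" "p < 1"
    and tail: "\<And>s. 0 \<le> s \<Longrightarrow> s \<le> t \<Longrightarrow> measure (distr M borel (\<lambda>\<omega>. X s \<omega> - x)) {y. \<delta> \<le> \<bar>y\<bar>} \<le> p"
  shows "\<P>(\<omega> in M. (\<exists>k\<le>n. X (t * real k / real n) \<omega> < \<delta>) \<and> 2 * \<delta> < X t \<omega>) \<le> p * (p / (1 - p))"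
proof -
  define ts where "ts i = t * real i / real n" for i
  define D where "D i \<omega> = X (ts (Suc i)) \<omega> - X (ts i) \<omega>" for i \<omega>
  have ts: "0 \<le> ts i" for i using \<open>0 < t\<close> by (simp add: ts_def)
  have ts_n: "ts n = t" using \<open>0 < n\<close> by (simp add: ts_def)
  have ts_le: "ts k \<le> t" if "k \<le> n" for k
    using that assms(1,2) by (simp add: ts_def field_simps)
  note [measurable] = measurable_X[OF ts] measurable_X[OF order_refl]
  have mX[measurable]: "X t \<in> borel_measurable M" using \<open>0 < t\<close> by (intro measurable_X) simp
  have S: "(\<Sum>i<k. D i \<omega>) = X (ts k) \<omega> - X 0 \<omega>" for k \<omega>
    using sum_lessThan_telescope[of "\<lambda>i. X (ts i) \<omega>" k] by (simp add: D_def ts_def)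
  have indep: "indep_vars (\<lambda>_. borel) D {..<n}"
    unfolding D_def using \<open>0 < t\<close> by (intro indep_increments ts mono_onI) (simp add: ts_def divide_right_mono)
  have inc: "\<P>(\<omega> in M. \<delta> \<le> \<bar>(\<Sum>i<n. D i \<omega>) - (\<Sum>i<k. D i \<omega>)\<bar>) \<le> p" if "k \<le> n" for k
  proof -
    define s where "s = t - ts k"
    have s: "0 \<le> s" "s \<le> t" using ts_le[OF that] ts[of k] by (auto simp: s_def)
    note [measurable] = measurable_X[OF s(1)]
    have "\<P>(\<omega> in M. \<delta> \<le> \<bar>(\<Sum>i<n. D i \<omega>) - (\<Sum>i<k. D i \<omega>)\<bar>)
        = \<P>(\<omega> in M. \<delta> \<le> \<bar>X (ts k + s) \<omega> - X (ts k) \<omega>\<bar>)"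
      by (simp add: S ts_n s_def)
    also have "\<dots> = measure (distr M borel (\<lambda>\<omega>. X (ts k + s) \<omega> - X (ts k) \<omega>)) {y. \<delta> \<le> \<bar>y\<bar>}"
      using measurable_X[of "ts k + s"] ts[of k] s by (subst measure_distr) (auto intro!: arg_cong[where f = prob])
    also have "\<dots> = measure (distr M borel (\<lambda>\<omega>. X s \<omega> - X 0 \<omega>)) {y. \<delta> \<le> \<bar>y\<bar>}"
      using stationary_increments[OF ts s(1), of k] by simp
    also have "distr M borel (\<lambda>\<omega>. X s \<omega> - X 0 \<omega>) = distr M borel (\<lambda>\<omega>. X s \<omega> - x)"
      using start by (intro distr_cong_AE) auto
    also have "measure \<dots> {y. \<delta> \<le> \<bar>y\<bar>} \<le> p"
      by (rule tail[OF s])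
    finally show ?thesis .
  qed
  have "\<P>(\<omega> in M. (\<exists>k\<le>n. X (t * real k / real n) \<omega> < \<delta>) \<and> 2 * \<delta> < X t \<omega>)
      = \<P>(\<omega> in M. (\<exists>k\<le>n. (\<Sum>i<k. D i \<omega>) < \<delta> - x) \<and> (\<delta> - x) + \<delta> < (\<Sum>i<n. D i \<omega>))"
    unfolding S ts_n ts_def[symmetric]
  \<comment> \<open>The path starts at x only almost surely, so the two events are compared up to a
    null set.\<close>
  proof (rule measure_eq_AE)
    show "AE \<omega> in M. \<omega> \<in> {\<omega> \<in> space M. (\<exists>k\<le>n. X (ts k) \<omega> < \<delta>) \<and> 2 * \<delta> < X t \<omega>} \<longleftrightarrow>
        \<omega> \<in> {\<omega> \<in> space M. (\<exists>k\<le>n. X (ts k) \<omega> - X 0 \<omega> < \<delta> - x) \<and> \<delta> - x + \<delta> < X t \<omega> - X 0 \<omega>}"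
      using start by eventually_elim auto
  qed measurable
  also have "\<dots> \<le> p * (p / (1 - p))"
    using assms by (intro first_passage_return_bound[OF indep] inc) auto
  finally show ?thesis .
qed

text \<open>On each dyadic grid, either the end point lies in (0, 2 \<delta>], which is the window
  term, or the path has dropped below \<delta> and returned above 2 \<delta>, which is the grid
  bound. Neither estimate depends on the mesh, and dyadic grids are nested, so continuity from below
  carries the sum over to the union.\<close>

lemma passage_return_superset:
  assumes "0 < t" "0 < \<delta>" "3 * \<delta> \<le> x" "0 \<le> p" "p < 1"
    and tail: "\<And>s. 0 \<le> s \<Longrightarrow> s \<le> t \<Longrightarrow> measure (distr M borel (\<lambda>\<omega>. X s \<omega> - x)) {y. \<delta> \<le> \<bar>y\<bar>} \<le> p"
  shows "\<exists>N\<in>events. {\<omega> \<in> space M. passage_time X \<omega> \<le> ereal t \<and> 0 < X t \<omega>} \<subseteq> N \<and>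
    prob N \<le> measure (distr M borel (\<lambda>\<omega>. X t \<omega> - x)) {- x<..- x + 2 * \<delta>} + p * (p / (1 - p))"
proof -
  define E where "E m = {\<omega> \<in> space M. (\<exists>k\<le>2 ^ m. X (t * real k / 2 ^ m) \<omega> < \<delta>) \<and> 0 < X t \<omega>}" for m :: nat
  have mX[measurable]: "X t \<in> borel_measurable M" using \<open>0 < t\<close> by (intro measurable_X) simp
  have grid[measurable]: "X (t * real k / 2 ^ m) \<in> borel_measurable M" for k m
    using \<open>0 < t\<close> by (intro measurable_X) simp
  have E_sets: "E m \<in> events" for m
    unfolding E_def by measurable
  have "{\<omega> \<in> space M. passage_time X \<omega> \<le> ereal t \<and> 0 < X t \<omega>} \<subseteq> (\<Union>m. E m)"
    using cadlag_passage_dyadic[OF cadlag_paths \<open>0 < t\<close> _ _ \<open>0 < \<delta>\<close>]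
    by (fastforce simp: E_def passage_time_def)
  moreover have "(\<Union>m. E m) \<in> events"
    using E_sets by auto
  moreover have "prob (\<Union>m. E m) \<le> measure (distr M borel (\<lambda>\<omega>. X t \<omega> - x)) {- x<..- x + 2 * \<delta>} + p * (p / (1 - p))"
  proof (rule LIMSEQ_le_const2)
    have "E m \<subseteq> E (Suc m)" for m
    proof
      fix \<omega> assume "\<omega> \<in> E m"
      then obtain k where k: "k \<le> 2 ^ m" "X (t * real k / 2 ^ m) \<omega> < \<delta>" "\<omega> \<in> space M" "0 < X t \<omega>"
        by (auto simp: E_def)
      moreover have "t * real (2 * k) / 2 ^ Suc m = t * real k / 2 ^ m" by simp
      ultimately have "2 * k \<le> 2 ^ Suc m" "X (t * real (2 * k) / 2 ^ Suc m) \<omega> < \<delta>" by simp_all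
      with k show "\<omega> \<in> E (Suc m)" unfolding E_def by blast
    qed
    then have "incseq E" by (rule incseq_SucI)
    then show "(\<lambda>m. prob (E m)) \<longlonglongrightarrow> prob (\<Union>m. E m)"
      using E_sets by (intro finite_Lim_measure_incseq) auto
    have "prob (E m) \<le> measure (distr M borel (\<lambda>\<omega>. X t \<omega> - x)) {- x<..- x + 2 * \<delta>} + p * (p / (1 - p))" for m
    proof -
      have "prob (E m) \<le> prob ({\<omega> \<in> space M. X t \<omega> - x \<in> {- x<..- x + 2 * \<delta>}}
          \<union> {\<omega> \<in> space M. (\<exists>k\<le>2 ^ m. X (t * real k / 2 ^ m) \<omega> < \<delta>) \<and> 2 * \<delta> < X t \<omega>})"
        by (intro finite_measure_mono) (auto simp: E_def)
      also have "\<dots> \<le> prob {\<omega> \<in> space M. X t \<omega> - x \<in> {- x<..- x + 2 * \<delta>}}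
          + \<P>(\<omega> in M. (\<exists>k\<le>2 ^ m. X (t * real k / 2 ^ m) \<omega> < \<delta>) \<and> 2 * \<delta> < X t \<omega>)"
        by (rule measure_Un_le) measurable
      also have "prob {\<omega> \<in> space M. X t \<omega> - x \<in> {- x<..- x + 2 * \<delta>}} = measure (distr M borel (\<lambda>\<omega>. X t \<omega> - x)) {- x<..- x + 2 * \<delta>}"
        by (subst measure_distr) (auto intro!: arg_cong[where f = prob])
      also have "\<P>(\<omega> in M. (\<exists>k\<le>2 ^ m. X (t * real k / 2 ^ m) \<omega> < \<delta>) \<and> 2 * \<delta> < X t \<omega>) \<le> p * (p / (1 - p))"
        using grid_return_bound[OF \<open>0 < t\<close> _ assms(2-5) tail, of "2 ^ m"] by simp
      finally show ?thesis by simp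
    qed
    then show "\<exists>N. \<forall>m\<ge>N. prob (E m) \<le> measure (distr M borel (\<lambda>\<omega>. X t \<omega> - x)) {- x<..- x + 2 * \<delta>} + p * (p / (1 - p))"
      by blast
  qed
  ultimately show ?thesis by blast
qed

end

section \<open>The limit at time zero\<close>

theorem theorem2:
  fixes P :: "real \<Rightarrow> 'a measure" and X :: "real \<Rightarrow> 'a \<Rightarrow> real"
    and \<alpha> cp cm x :: real and f :: "real \<Rightarrow> real"
  assumes "0 < \<alpha>" and "\<alpha> < 2"
    and "0 \<le> cp" and "0 \<le> cm" and "0 < cp + cm"
    and "\<alpha> = 1 \<Longrightarrow> cp = cm"
    and "\<And>y. stable_process \<alpha> cp cm (P y) X y"
    and "\<not> subordinator (P 0) X"
    and "\<not> subordinator (P 0) (\<lambda>t \<omega>. - X t \<omega>)"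
    and "0 < x"
    and "continuous_on UNIV f" and "bounded (range f)"
  shows "((\<lambda>t. 1 / t *
            expectation_completed (P x) (\<lambda>\<omega>.
               f (X t \<omega>) * indicator {\<omega>. passage_time X \<omega> \<le> ereal t \<and> X t \<omega> \<in> {0<..}} \<omega>))
          \<longlongrightarrow> f x / x powr \<alpha>
                * (passage_constant \<alpha> cp cm (negativity_parameter (P 0) X) - cm / \<alpha>))
         (at_right 0)"
proof -
  interpret stable_parameters \<alpha> cp cm
    using assms(1-5) by unfold_locales
  have stable: "levy_process (P y) X y"
    "\<And>t u. 0 \<le> t \<Longrightarrow> char (distr (P y) borel (\<lambda>\<omega>. X t \<omega> - y)) u = exp (of_real t * \<psi> u)" for y
    using assms(7)[of y] by (auto simp: stable_process_def)
  interpret L0: levy_process "P 0" X 0 by (rule stable(1))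
  interpret Lx: levy_process "P x" X x by (rule stable(1))

  have "passage_constant \<alpha> cp cm (negativity_parameter (P 0) X) = cm / \<alpha>"
  proof (cases "\<alpha> = 1")
    case True
    then show ?thesis using assms(6) by (simp add: passage_constant_def)
  next
    case False
    have [measurable]: "X 1 \<in> borel_measurable (P 0)" by (rule L0.measurable_X) simp
    let ?M = "distr (P 0) borel (\<lambda>\<omega>. X 1 \<omega> - 0)"
    have "negativity_parameter (P 0) X = measure ?M {..<0}"
      unfolding negativity_parameter_def
      by (subst measure_distr) (auto intro!: arg_cong[where f = "measure (P 0)"])
    also have "\<dots> = 1 / 2 - arctan (stable_skewness cp cm * tan (pi * \<alpha> / 2)) / (pi * \<alpha>)"
      using stable(2)[of 1 0] by (intro stable_negativity[OF False] L0.real_distribution_distr) auto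
    finally show ?thesis by (rule passage_constant_eq[OF False])
  qed
  then have limit: "f x / x powr \<alpha> * (passage_constant \<alpha> cp cm (negativity_parameter (P 0) X) - cm / \<alpha>) = 0"
    by simp

  define G where "G t \<omega> = f (X t \<omega>) * indicator {\<omega>. passage_time X \<omega> \<le> ereal t \<and> X t \<omega> \<in> {0<..}} \<omega>" for t \<omega>
  define \<mu> where "\<mu> t = distr (P x) borel (\<lambda>\<omega>. X t \<omega> - x)" for t
  have \<mu>: "real_distribution (\<mu> t)" "char (\<mu> t) u = exp (of_real t * \<psi> u)" if "0 \<le> t" for t u
  proof -
    have [measurable]: "X t \<in> borel_measurable (P x)" by (rule Lx.measurable_X[OF that])
    show "real_distribution (\<mu> t)" unfolding \<mu>_def by (rule Lx.real_distribution_distr) measurable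
    show "char (\<mu> t) u = exp (of_real t * \<psi> u)" unfolding \<mu>_def by (rule stable(2)[OF that])
  qed
  obtain B where B: "0 < B" "\<And>y. \<bar>f y\<bar> \<le> B"
    using assms(12) by (auto simp: bounded_pos)
  have "\<forall>\<^sub>F t in at_right 0. \<bar>1 / t * expectation_completed (P x) (G t)\<bar> < e" if "0 < e" for e
  proof -
    \<comment> \<open>Two errors of size \<open>e' * t\<close>, multiplied by B, make 2 e t / 3,
      strictly below e t.\<close>
    define e' where "e' = e / (3 * B)"
    have e': "0 < e'" using that B by (simp add: e'_def)
    \<comment> \<open>The window has length 2 \<delta>, and the path estimate requires 3 \<delta>
      \<le> x; hence the cap 2 x / 3.\<close>
    obtain \<delta>' where \<delta>': "0 < \<delta>'" "\<delta>' \<le> 2 * x / 3"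
      and window: "\<forall>\<^sub>F t in at_right 0. measure (\<mu> t) {- x<..- x + \<delta>'} \<le> e' * t"
      using exponent_window_bound[of \<mu> x e' "2 * x / 3"] \<mu> \<open>0 < x\<close> e' by auto
    define \<delta> where "\<delta> = \<delta>' / 2"
    have \<delta>: "0 < \<delta>" "3 * \<delta> \<le> x" "\<delta>' = 2 * \<delta>" using \<delta>' by (auto simp: \<delta>_def)
    obtain C where C: "0 \<le> C" "\<And>s. 0 \<le> s \<Longrightarrow> measure (\<mu> s) {y. \<delta> \<le> \<bar>y\<bar>} \<le> C * s"
    proof -
      from exponent_tail_bound[OF \<delta>(1)] obtain C where C0: "0 \<le> C" and H:
        "\<forall>t\<ge>0. \<forall>M. real_distribution M \<longrightarrow> (\<forall>u. char M u = exp (of_real t * \<psi> u)) \<longrightarrow>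
          measure M {y. \<delta> \<le> \<bar>y\<bar>} \<le> C * t"
        by (elim exE conjE)
      have "measure (\<mu> s) {y. \<delta> \<le> \<bar>y\<bar>} \<le> C * s" if "0 \<le> s" for s
        using H[rule_format, OF that \<mu>(1)[OF that] \<mu>(2)[OF that]] .
      then show thesis
        by (rule that[OF C0])
    qed
    \<comment> \<open>This is the return term p^2 / (1 - p) with p = C t, divided by t; it still
      tends to 0.\<close>
    have "((\<lambda>t. C * (C * t / (1 - C * t))) \<longlongrightarrow> C * (C * 0 / (1 - C * 0))) (at_right 0)"
      by (intro tendsto_intros) auto
    then have small: "\<forall>\<^sub>F t in at_right 0. C * (C * t / (1 - C * t)) < e'"
      using e' by (intro order_tendstoD(2)) auto
    have "((\<lambda>t. C * t) \<longlongrightarrow> C * 0) (at_right 0)"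
      by (intro tendsto_intros)
    then have "\<forall>\<^sub>F t in at_right 0. C * t < 1"
      by (rule order_tendstoD(2)) simp
    with window small eventually_at_right_less[of 0]
    show ?thesis
    proof eventually_elim
      case (elim t)
      \<comment> \<open>The linear tail bound increases in time, so p = C t serves all times up to t
        at once.\<close>
      have "measure (\<mu> s) {y. \<delta> \<le> \<bar>y\<bar>} \<le> C * t" if "0 \<le> s" "s \<le> t" for s
        using C(2)[OF that(1)] mult_left_mono[OF that(2) C(1)] by linarith
      then obtain N where N: "N \<in> sets (P x)" "{\<omega> \<in> space (P x). passage_time X \<omega> \<le> ereal t \<and> 0 < X t \<omega>} \<subseteq> N"
        "measure (P x) N \<le> measure (\<mu> t) {- x<..- x + 2 * \<delta>} + C * t * (C * t / (1 - C * t))"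
        using Lx.passage_return_superset[of t \<delta> "C * t"] elim \<delta> C(1) unfolding \<mu>_def by auto
      have "\<bar>expectation_completed (P x) (G t)\<bar> \<le> B * measure (P x) N"
      proof (rule abs_expectation_completed_le[OF Lx.finite_measure_axioms N(1)])
        show "\<bar>G t \<omega>\<bar> \<le> B * indicator N \<omega>" if "\<omega> \<in> space (P x)" for \<omega>
          using that N(2) B(2)[of "X t \<omega>"] B(1) by (auto simp: G_def indicator_def)
      qed (use B in simp)
      also have "\<dots> \<le> B * (e' * t + t * (C * (C * t / (1 - C * t))))"
        using N(3) elim(1) B(1) unfolding \<delta>(3) by (intro mult_left_mono) (auto simp: mult_ac)
      also have "\<dots> \<le> B * (e' * t + t * e')"
        using elim B(1) by (intro mult_left_mono add_left_mono) auto
      also have "\<dots> = t * (2 * e / 3)"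
        using B(1) by (simp add: e'_def field_simps)
      also have "\<dots> < t * e"
        using elim that by simp
      finally show ?case
        using elim(3) by (simp add: abs_mult field_simps)
    qed
  qed
  then have "((\<lambda>t. 1 / t * expectation_completed (P x) (G t)) \<longlongrightarrow> 0) (at_right 0)"
    by (auto simp: tendsto_iff dist_real_def)
  then show ?thesis
    unfolding limit G_def .
qed

end
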